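(* Let $\alpha>0$, let $\nu$ be a probability measure on $\mathbb{R}_+=[0,\infty)$ with cumulative distribution function $F$ and tail $\overline F=1-F$, let $m_\nu^{(\alpha)}=\int_0^\infty x^\alpha\,\nu(dx)$, and let $\{X_n:n\in\mathbb{N}_0\}$ be a Kendall random walk with parameter $\alpha$ and unit step distribution $\nu$. For $n\in\mathbb{N}$ let $\overline F_n(x)=\nu^{\vartriangle_\alpha n}((x,\infty))$ be the tail of the $n$-fold Kendall convolution of $\nu$ (the tail of the distribution of $X_n$). (i) If $\overline F$ is regularly varying at infinity with index $\theta-\alpha$, where $0<\theta<\alpha$, then $$\overline F_n(x)=n\overline F(x)(1+o(1))\qquad\text{as }x\to\infty .$$ (ii) If $m_\nu^{(\alpha)}<\infty$, then $$\overline F_n(x)=n\overline F(x)+\frac12 n(n-1)\left(m_\nu^{(\alpha)}\right)^2x^{-2\alpha}(1+o(1))\qquad\text{as }x\to\infty .$$ (iii) If $\overline F(x)=o(x^{-2\alpha})$ as $x\to\infty$, then $$\overline F_n(x)=\frac12 n(n-1)\left(m_\nu^{(\alpha)}\right)^2x^{-2\alpha}(1+o(1))\qquad\text{as }x\to\infty .$$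
   Context: Kendall convolution: for $x,y\ge0$, with $m=\min\{x,y\}$, $M=\max\{x,y\}$, $\varrho=m/M$, $$\delta_x\vartriangle_\alpha\delta_y:=T_M\left(\varrho^\alpha\pi_{2\alpha}+(1-\varrho^\alpha)\delta_1\right),$$ where $T_a\lambda$ is the law of $aX$ when $X$ has law $\lambda$, and $\pi_{2\alpha}(dy)=2\alpha y^{-2\alpha-1}\mathbf{1}_{[1,\infty)}(y)\,dy$ is a Pareto law (for $x=y=0$ the result is $\delta_0$). For probability measures $\nu_1,\nu_2$ on $[0,\infty)$, $(\nu_1\vartriangle_\alpha\nu_2)(A)=\int_0^\infty\int_0^\infty(\delta_x\vartriangle_\alpha\delta_y)(A)\,\nu_1(dx)\nu_2(dy)$. $\nu^{\vartriangle_\alpha n}=\nu\vartriangle_\alpha\cdots\vartriangle_\alpha\nu$ ($n$ times), with $\nu^{\vartriangle_\alpha 1}=\nu$. The Kendall random walk with parameter $\alpha$ and unit step distribution $\nu$ is the Markov process with $X_0=1$, $X_1$ distributed as $\nu$, and, for $n\ge1$, one-step transitions $P(X_{n+1}\in A\mid X_n=x)=(\delta_x\vartriangle_\alpha\nu)(A)$; $X_n$ has distribution $\nu^{\vartriangle_\alpha n}$ for $n\ge1$. $\mathbb{N}=\{1,2,\dots\}$, $\mathbb{N}_0=\mathbb{N}\cup\{0\}$. A measurable positive function $f$ is regularly varying at infinity with index $\beta$ if $\lim_{t\to\infty}f(tx)/f(t)=x^\beta$ for all $x>0$.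
   Formalization: In (iii) the factor form (1+o(1)) is claimed only for n ≥ 2, since for n = 1 it would say the tail of ν vanishes eventually (false for exponential ν); for all n ≥ 1 the form with additive error o(x^{-2α}) is given, and finiteness of the moment is proved as well. *)

theory Defs
  imports "HOL-Probability.Probability"
begin

text \<open>
  Probability measures on \<open>[0, \<infinity>)\<close> are represented as Borel measures on the real line
  that give no mass to the negative half-line.
\<close>

definition dilation :: "real \<Rightarrow> real measure \<Rightarrow> real measure" where
  "dilation a \<mu> = distr \<mu> borel (\<lambda>x. a * x)"

definition pareto :: "real \<Rightarrow> real measure" where
  "pareto a = density lborel (\<lambda>y. ennreal (indicator {1..} y * (a * y powr (- a - 1))))"

definition mixture :: "real \<Rightarrow> real measure \<Rightarrow> real measure \<Rightarrow> real measure" where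
  "mixture p \<mu> \<nu> = measure_of UNIV (sets borel)
     (\<lambda>A. ennreal p * emeasure \<mu> A + ennreal (1 - p) * emeasure \<nu> A)"

text \<open>
  For \<open>x = y = 0\<close> the quotient is \<open>0 / 0 = 0\<close>, so the right-hand side
  is the Dirac measure at \<open>0\<close>, as it should be.
\<close>

definition kendall_dirac :: "real \<Rightarrow> real \<Rightarrow> real \<Rightarrow> real measure" where
  "kendall_dirac \<alpha> x y =
     (let \<rho> = min x y / max x y
      in dilation (max x y) (mixture (\<rho> powr \<alpha>) (pareto (2 * \<alpha>)) (return borel 1)))"

definition kendall_conv :: "real \<Rightarrow> real measure \<Rightarrow> real measure \<Rightarrow> real measure" where
  "kendall_conv \<alpha> \<nu>1 \<nu>2 = measure_of UNIV (sets borel)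
     (\<lambda>A. \<integral>\<^sup>+y\<in>{0..}. (\<integral>\<^sup>+x\<in>{0..}. emeasure (kendall_dirac \<alpha> x y) A \<partial>\<nu>1) \<partial>\<nu>2)"

text \<open>The powers of interest are those with exponent at least 1; the Dirac measure at
  \<open>0\<close> is the neutral element of the convolution.\<close>

fun kendall_power :: "real \<Rightarrow> real measure \<Rightarrow> nat \<Rightarrow> real measure" where
  "kendall_power \<alpha> \<nu> 0 = return borel 0"
| "kendall_power \<alpha> \<nu> (Suc 0) = \<nu>"
| "kendall_power \<alpha> \<nu> (Suc (Suc n)) = kendall_conv \<alpha> (kendall_power \<alpha> \<nu> (Suc n)) \<nu>"

text \<open>
  The Markov property is stated with respect to the natural filtration. The first step is
  special: \<open>X 1\<close> has law \<open>\<nu>\<close>, which is not what the transition kernel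
  would give when started in \<open>1\<close>.
\<close>

definition kendall_random_walk ::
    "real \<Rightarrow> real measure \<Rightarrow> 'a measure \<Rightarrow> (nat \<Rightarrow> 'a \<Rightarrow> real) \<Rightarrow> bool" where
  "kendall_random_walk \<alpha> \<nu> M X \<longleftrightarrow>
     prob_space M \<and>
     (\<forall>n. X n \<in> borel_measurable M) \<and>
     (\<forall>n. AE \<omega> in M. 0 \<le> X n \<omega>) \<and>
     (AE \<omega> in M. X 0 \<omega> = 1) \<and>
     distr M borel (X 1) = \<nu> \<and>
     (\<forall>n\<ge>1. \<forall>A\<in>sets borel. AE \<omega> in M.
        real_cond_exp M
          (sigma (space M) {X k -` B \<inter> space M | k B. k \<le> n \<and> B \<in> sets borel})
          (indicator (X (Suc n) -` A)) \<omega>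
        = measure (kendall_conv \<alpha> (return borel (X n \<omega>)) \<nu>) A)"

definition tail :: "real measure \<Rightarrow> real \<Rightarrow> real" where
  "tail \<nu> x = 1 - cdf \<nu> x"

definition kendall_tail :: "real \<Rightarrow> real measure \<Rightarrow> nat \<Rightarrow> real \<Rightarrow> real" where
  "kendall_tail \<alpha> \<nu> n x = measure (kendall_power \<alpha> \<nu> n) {x<..}"

definition moment :: "real \<Rightarrow> real measure \<Rightarrow> ennreal" where
  "moment \<alpha> \<nu> = (\<integral>\<^sup>+x\<in>{0..}. ennreal (x powr \<alpha>) \<partial>\<nu>)"

definition regularly_varying :: "real \<Rightarrow> (real \<Rightarrow> real) \<Rightarrow> bool" where
  "regularly_varying \<beta> f \<longleftrightarrow>
     f \<in> borel_measurable (restrict_space borel {0<..}) \<and>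
     (\<forall>t>0. f t > 0) \<and>
     (\<forall>x>0. ((\<lambda>t. f (t * x) / f t) \<longlongrightarrow> x powr \<beta>) at_top)"

text \<open>
  A measure defined by \<open>measure_of\<close> is the null measure unless the given set function is
  countably additive. The following facts show that this does not happen
  above for probability measures.
\<close>

lemma sets_mixture [simp, measurable_cong]: "sets (mixture p \<mu> \<nu>) = sets borel"
  by (simp add: mixture_def sets.sigma_sets_eq[of borel, simplified])

lemma sets_kendall_conv [simp, measurable_cong]: "sets (kendall_conv \<alpha> \<mu> \<nu>) = sets borel"
  by (simp add: kendall_conv_def sets.sigma_sets_eq[of borel, simplified])

lemma emeasure_mixture:
  assumes "sets \<mu> = sets borel" "sets \<nu> = sets borel" "A \<in> sets borel"
  shows "emeasure (mixture p \<mu> \<nu>) A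
    = ennreal p * emeasure \<mu> A + ennreal (1 - p) * emeasure \<nu> A"
  unfolding mixture_def
proof (rule emeasure_measure_of_sigma)
  show "sigma_algebra UNIV (sets (borel::real measure))"
    using sets.sigma_algebra_axioms[of "borel::real measure"] by simp
  show "positive (sets borel) (\<lambda>A. ennreal p * emeasure \<mu> A + ennreal (1 - p) * emeasure \<nu> A)"
    by (simp add: positive_def)
  show "countably_additive (sets borel)
      (\<lambda>A. ennreal p * emeasure \<mu> A + ennreal (1 - p) * emeasure \<nu> A)"
  proof (rule countably_additiveI)
    fix B :: "nat \<Rightarrow> real set"
    assume B: "range B \<subseteq> sets borel" "disjoint_family B" "(\<Union>i. B i) \<in> sets borel"
    have "(\<Sum>i. emeasure \<mu> (B i)) = emeasure \<mu> (\<Union>i. B i)"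
         "(\<Sum>i. emeasure \<nu> (B i)) = emeasure \<nu> (\<Union>i. B i)"
      using B assms by (auto intro!: suminf_emeasure)
    then show "(\<Sum>i. ennreal p * emeasure \<mu> (B i) + ennreal (1 - p) * emeasure \<nu> (B i))
        = ennreal p * emeasure \<mu> (\<Union>i. B i) + ennreal (1 - p) * emeasure \<nu> (\<Union>i. B i)"
      by (simp add: suminf_add[symmetric])
  qed
qed fact

lemma sets_pareto [simp, measurable_cong]: "sets (pareto a) = sets borel"
  by (simp add: pareto_def)

lemma sets_kendall_dirac [simp, measurable_cong]: "sets (kendall_dirac \<alpha> x y) = sets borel"
  by (simp add: kendall_dirac_def dilation_def Let_def)

lemma emeasure_kendall_dirac:
  assumes [measurable]: "A \<in> sets borel"
  shows "emeasure (kendall_dirac \<alpha> x y) A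
    = ennreal ((min x y / max x y) powr \<alpha>)
        * (\<integral>\<^sup>+z. ennreal (indicator {1..} z * (2 * \<alpha> * z powr (- (2 * \<alpha>) - 1)))
             * indicator A (max x y * z) \<partial>lborel)
      + ennreal (1 - (min x y / max x y) powr \<alpha>) * indicator A (max x y)"
proof -
  let ?B = "(\<lambda>z. max x y * z) -` A"
  have B [measurable]: "?B \<in> sets borel"
    using measurable_sets[of "\<lambda>z. max x y * z" borel borel A] by simp
  have ind: "indicator ?B z = (indicator A (max x y * z) :: ennreal)" for z
    by (simp add: indicator_def)
  have "emeasure (kendall_dirac \<alpha> x y) A
      = emeasure (mixture ((min x y / max x y) powr \<alpha>) (pareto (2 * \<alpha>)) (return borel 1)) ?B"
    unfolding kendall_dirac_def dilation_def Let_def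
    by (subst emeasure_distr) (auto simp: sets_eq_imp_space_eq[OF sets_mixture])
  then show ?thesis
    by (simp add: emeasure_mixture pareto_def emeasure_density ind)
qed

lemma emeasure_kendall_dirac_measurable:
  assumes [measurable]: "A \<in> sets borel"
  shows "(\<lambda>(x, y). emeasure (kendall_dirac \<alpha> x y) A) \<in> borel_measurable (borel \<Otimes>\<^sub>M borel)"
  unfolding emeasure_kendall_dirac[OF assms] by measurable

lemma emeasure_kendall_conv:
  assumes "real_distribution \<mu>" "real_distribution \<nu>" "A \<in> sets borel"
  shows "emeasure (kendall_conv \<alpha> \<mu> \<nu>) A
    = (\<integral>\<^sup>+y\<in>{0..}. (\<integral>\<^sup>+x\<in>{0..}. emeasure (kendall_dirac \<alpha> x y) A \<partial>\<mu>) \<partial>\<nu>)"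
  unfolding kendall_conv_def
proof (rule emeasure_measure_of_sigma)
  interpret \<mu>: real_distribution \<mu> by fact
  interpret \<nu>: real_distribution \<nu> by fact
  have [measurable_cong]: "sets \<mu> = sets borel" "sets \<nu> = sets borel"
    by simp_all
  let ?F = "\<lambda>A. \<integral>\<^sup>+y\<in>{0..}. (\<integral>\<^sup>+x\<in>{0..}. emeasure (kendall_dirac \<alpha> x y) A \<partial>\<mu>) \<partial>\<nu>"
  show "sigma_algebra UNIV (sets (borel::real measure))"
    using sets.sigma_algebra_axioms[of "borel::real measure"] by simp
  show "positive (sets borel) ?F"
    by (simp add: positive_def)
  have meas: "(\<lambda>(y, x). emeasure (kendall_dirac \<alpha> x y) B) \<in> borel_measurable (borel \<Otimes>\<^sub>M borel)"
    if "B \<in> sets borel" for B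
    unfolding emeasure_kendall_dirac[OF that] using that by measurable
  show "countably_additive (sets borel) ?F"
  proof (rule countably_additiveI)
    fix B :: "nat \<Rightarrow> real set"
    assume B: "range B \<subseteq> sets borel" "disjoint_family B" "(\<Union>i. B i) \<in> sets borel"
    have B' [measurable]: "B i \<in> sets borel" for i
      using B by auto
    define g where "g i y x = emeasure (kendall_dirac \<alpha> x y) (B i)" for i y x
    have g [measurable]: "(\<lambda>(y, x). g i y x) \<in> borel_measurable (borel \<Otimes>\<^sub>M borel)" for i
      unfolding g_def by (rule meas[OF B'])
    have g1: "(\<lambda>x. g i y x * indicator {0..} x) \<in> borel_measurable \<mu>" for i y
      by measurable
    have "(\<lambda>y. (\<integral>\<^sup>+x. g i y x * indicator {0..} x \<partial>\<mu>) * indicator {0..} y) \<in> borel_measurable borel" for i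
      by measurable
    then have g2: "(\<lambda>y. (\<integral>\<^sup>+x. g i y x * indicator {0..} x \<partial>\<mu>) * indicator {0..} y) \<in> borel_measurable \<nu>" for i
      by (simp add: measurable_def)
    have "(\<Sum>i. ?F (B i)) = (\<Sum>i. \<integral>\<^sup>+y\<in>{0..}. (\<integral>\<^sup>+x\<in>{0..}. g i y x \<partial>\<mu>) \<partial>\<nu>)"
      by (simp add: g_def)
    also have "\<dots> = (\<integral>\<^sup>+y\<in>{0..}. (\<Sum>i. \<integral>\<^sup>+x\<in>{0..}. g i y x \<partial>\<mu>) \<partial>\<nu>)"
      by (subst nn_integral_suminf[OF g2, symmetric]) simp
    also have "\<dots> = (\<integral>\<^sup>+y\<in>{0..}. (\<integral>\<^sup>+x\<in>{0..}. (\<Sum>i. g i y x) \<partial>\<mu>) \<partial>\<nu>)"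
      by (subst nn_integral_suminf[OF g1, symmetric]) simp
    also have "\<dots> = ?F (\<Union>i. B i)"
      using B by (simp add: g_def suminf_emeasure)
    finally show "(\<Sum>i. ?F (B i)) = ?F (\<Union>i. B i)" .
  qed
qed fact

end

theory Submission
  imports Defs "HOL-Library.Landau_Symbols"
begin

text \<open>
  For a law \<open>\<mu>\<close> on the half-line and a level \<open>t > 0\<close>, let \<open>F(t) = \<mu>[0,t]\<close> and
  let \<open>H(t)\<close> be the integral of \<open>(x/t)\<^sup>\<alpha>\<close> over \<open>[0,t]\<close>. Two elementary Pareto integrals
  (\<open>kendall_dirac_truncated\<close>) show that on point masses, and therefore by Fubini on all laws
  (\<open>kendall_conv_truncated\<close>), the convolution acts on the pair \<open>(F, H)\<close> at each fixed level
  by polynomials: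
  \<open>F\<^sub>1\<^sub>2 = F\<^sub>1 F\<^sub>2 - H\<^sub>1 H\<^sub>2\<close> and \<open>H\<^sub>1\<^sub>2 = H\<^sub>1 F\<^sub>2 + F\<^sub>1 H\<^sub>2 - 2 H\<^sub>1 H\<^sub>2\<close>. In other words
  \<open>\<Phi> = F - H\<close>, the Williamson transform, is multiplicative and \<open>H\<close> is a derivation over it:
  \<open>H\<^sub>1\<^sub>2 = H\<^sub>1 \<Phi>\<^sub>2 + \<Phi>\<^sub>1 H\<^sub>2\<close>. Hence the \<open>n\<close>-th power has distribution function
  \<open>\<Phi>\<^sup>n + n \<Phi>^(n-1) H\<close> exactly (\<open>kendall_tail_closed_form\<close>).

  Write \<open>T = 1 - F\<close>, so that \<open>\<Phi> = 1 - (T + H)\<close>. Expanding to second order, the mixed terms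
  \<open>T H\<close> cancel, and the tail of the power is
  \<open>n T + n(n-1)/2 (H\<^sup>2 - T\<^sup>2) + O((T + H)\<^sup>3)\<close> (\<open>kendall_tail_expansion\<close>).
  What remains is to compare \<open>T\<close> and \<open>H\<close>.

  For a regularly varying tail, \<open>H(2t) \<le> 2^(-\<alpha>) H(t) + T(t)\<close>, while \<open>T\<close> loses
  asymptotically only the factor \<open>2^(\<theta>-\<alpha>)\<close> under doubling; iterating gives \<open>H = O(T)\<close>
  (\<open>truncated_moment_le_tail\<close>), and all terms after \<open>n T\<close> are \<open>O(T\<^sup>2)\<close>.

  If the moment \<open>m\<close> is finite, then \<open>t\<^sup>\<alpha> H(t)\<close> tends to \<open>m\<close> by dominated convergence and
  \<open>t\<^sup>\<alpha> T(t)\<close> to \<open>0\<close>. The cancellation of the mixed term is essential here: what is left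
  after \<open>n T\<close> is \<open>n(n-1)/2 m\<^sup>2 t^(-2\<alpha>)\<close> up to \<open>o(t^(-2\<alpha>))\<close>
  (\<open>kendall_tail_finite_moment\<close>). A tail that is \<open>o(t^(-2\<alpha>))\<close> is the
  subcase in which \<open>n T\<close> is negligible too; the same doubling inequality shows that the moment is
  then finite (\<open>moment_finite\<close>). When \<open>m = 0\<close> the law is the point mass at \<open>0\<close>, both sides of
  the relative form vanish, and the relative error is taken to be \<open>0\<close>.

  The laws of the walk are the convolution powers because integrating the conditional
  probabilities of the Markov property yields one convolution with the step law
  (\<open>kendall_walk_step\<close>).
\<close>

section \<open>Integration against the Kendall convolution of two point masses\<close>

locale nonneg_distribution = real_distribution \<mu> for \<mu> :: "real measure" +
  assumes AE_nonneg: "AE x in \<mu>. 0 \<le> x"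

text \<open>
  A mixture is given only through its values on sets; the formula passes from sets to functions
  by monotone approximation.
\<close>

lemma nn_integral_mixture:
  assumes [measurable_cong]: "sets \<mu> = sets borel" "sets \<nu> = sets borel"
    and "f \<in> borel_measurable borel"
  shows "(\<integral>\<^sup>+x. f x \<partial>mixture p \<mu> \<nu>)
    = ennreal p * (\<integral>\<^sup>+x. f x \<partial>\<mu>) + ennreal (1 - p) * (\<integral>\<^sup>+x. f x \<partial>\<nu>)"
  using assms(3)
proof (induction rule: borel_measurable_induct)
  case (cong f g)
  then have "f = g" by auto
  then show ?case using cong by simp
next
  case (set A)
  then show ?case
    using assms by (simp add: emeasure_mixture)
next
  case (mult u c)
  note [measurable] = \<open>u \<in> borel_measurable borel\<close>
  show ?case
    by (simp add: nn_integral_cmult mult.IH distrib_left mult.left_commute)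
next
  case (add u v)
  note [measurable] = \<open>u \<in> borel_measurable borel\<close> \<open>v \<in> borel_measurable borel\<close>
  have um: "u \<in> borel_measurable (mixture p \<mu> \<nu>)" "u \<in> borel_measurable \<mu>" "u \<in> borel_measurable \<nu>"
    by measurable
  have vm: "v \<in> borel_measurable (mixture p \<mu> \<nu>)" "v \<in> borel_measurable \<mu>" "v \<in> borel_measurable \<nu>"
    by measurable
  show ?case
    unfolding nn_integral_add[OF vm(1) um(1)] nn_integral_add[OF vm(2) um(2)]
      nn_integral_add[OF vm(3) um(3)]
    by (simp add: add.IH distrib_left ac_simps)
next
  case (seq U)
  note [measurable] = \<open>U _ \<in> borel_measurable borel\<close>
  have inc: "incseq (\<lambda>i. integral\<^sup>N M (U i))" for M :: "real measure"
    using \<open>incseq U\<close> by (auto simp: incseq_def le_fun_def intro!: nn_integral_mono)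
  have "(\<integral>\<^sup>+x. (SUP i. U i) x \<partial>mixture p \<mu> \<nu>) = (SUP i. integral\<^sup>N (mixture p \<mu> \<nu>) (U i))"
    using \<open>incseq U\<close> by (simp add: image_comp nn_integral_monotone_convergence_SUP)
  also have "\<dots> = (SUP i. ennreal p * integral\<^sup>N \<mu> (U i) + ennreal (1 - p) * integral\<^sup>N \<nu> (U i))"
    by (simp add: seq.IH)
  also have "\<dots> = ennreal p * (SUP i. integral\<^sup>N \<mu> (U i)) + ennreal (1 - p) * (SUP i. integral\<^sup>N \<nu> (U i))"
    by (subst ennreal_SUP_add)
       (auto simp: SUP_mult_left_ennreal intro!: incseq_SucI mult_left_mono incseq_SucD[OF inc])
  also have "\<dots> = ennreal p * (\<integral>\<^sup>+x. (SUP i. U i) x \<partial>\<mu>) + ennreal (1 - p) * (\<integral>\<^sup>+x. (SUP i. U i) x \<partial>\<nu>)"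
    using \<open>incseq U\<close> by (simp add: image_comp nn_integral_monotone_convergence_SUP)
  finally show ?case .
qed

lemma nn_integral_kendall_dirac:
  assumes [measurable]: "f \<in> borel_measurable borel"
  shows "(\<integral>\<^sup>+z. f z \<partial>kendall_dirac \<alpha> x y)
    = ennreal ((min x y / max x y) powr \<alpha>) * (\<integral>\<^sup>+z. f (max x y * z) \<partial>pareto (2 * \<alpha>))
      + ennreal (1 - (min x y / max x y) powr \<alpha>) * f (max x y)"
  unfolding kendall_dirac_def dilation_def Let_def
  by (simp add: nn_integral_distr nn_integral_mixture nn_integral_return)

lemma kendall_dirac_commute: "kendall_dirac \<alpha> x y = kendall_dirac \<alpha> y x"
  by (simp add: kendall_dirac_def min.commute max.commute)

text \<open>
  The exponents \<open>p = 0\<close> and \<open>p = \<alpha>\<close> with \<open>a = 2 \<alpha>\<close> are the two integrals behind the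
  action of the convolution on \<open>(F, H)\<close>.
\<close>

lemma pareto_truncated_power_integral:
  assumes "0 < a" "p < a" "1 \<le> c"
  shows "(\<integral>\<^sup>+z. ennreal (z powr p * indicator {..c} z) \<partial>pareto a)
    = ennreal (a / (a - p) * (1 - c powr (p - a)))"
proof -
  have "(\<integral>\<^sup>+z. ennreal (z powr p * indicator {..c} z) \<partial>pareto a)
      = (\<integral>\<^sup>+z. ennreal (a * z powr (p - a - 1)) * indicator {1..c} z \<partial>lborel)"
    unfolding pareto_def using assms
    by (subst nn_integral_density)
       (auto intro!: nn_integral_cong split: split_indicator
          simp: ennreal_mult'[symmetric] powr_add[symmetric] algebra_simps)
  also have "\<dots> = ennreal (- (a / (a - p)) * c powr (p - a) - (- (a / (a - p)) * 1 powr (p - a)))"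
  proof (rule nn_integral_FTC_Icc)
    fix z assume z: "z \<in> {1..c}"
    show "((\<lambda>z. - (a / (a - p)) * z powr (p - a)) has_real_derivative a * z powr (p - a - 1)) (at z)"
      using z assms
      by (auto intro!: derivative_eq_intros simp: divide_simps) (simp add: algebra_simps)
  qed (use assms in auto)
  also have "\<dots> = ennreal (a / (a - p) * (1 - c powr (p - a)))"
    by (simp add: algebra_simps)
  finally show ?thesis .
qed

lemma prob_space_pareto:
  assumes "0 < a"
  shows "prob_space (pareto a)"
proof
  have "emeasure (pareto a) (space (pareto a))
      = (\<integral>\<^sup>+z. ennreal (a * z powr (- a - 1)) * indicator {1..} z \<partial>lborel)"
    unfolding pareto_def
    by (subst emeasure_density)
       (auto intro!: nn_integral_cong simp: sets_eq_imp_space_eq split: split_indicator)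
  also have "\<dots> = ennreal (0 - (- (1 powr (- a))))"
  proof (rule nn_integral_FTC_atLeast)
    fix z :: real assume z: "1 \<le> z"
    show "((\<lambda>z. - (z powr (- a))) has_real_derivative a * z powr (- a - 1)) (at z)"
      using z assms by (auto intro!: derivative_eq_intros simp: field_simps powr_diff)
  next
    show "((\<lambda>z. - (z powr (- a))) \<longlongrightarrow> 0) at_top"
      using tendsto_minus[OF tendsto_neg_powr[of "- a" "\<lambda>z::real. z" at_top]] assms
      by (simp add: filterlim_ident)
  qed (use assms in auto)
  finally show "emeasure (pareto a) (space (pareto a)) = 1"
    by simp
qed

lemma ratio_powr_le_1:
  fixes x y :: real
  assumes "0 \<le> x" "0 \<le> y" "0 < \<alpha>"
  shows "(min x y / max x y) powr \<alpha> \<le> 1"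
proof -
  have "min x y / max x y \<le> 1" "0 \<le> min x y / max x y"
    using assms by (auto simp: divide_le_eq_1)
  then show ?thesis
    using powr_mono2[of \<alpha> "min x y / max x y" 1] assms by simp
qed

lemma prob_space_kendall_dirac:
  assumes "0 \<le> x" "0 \<le> y" "0 < \<alpha>"
  shows "prob_space (kendall_dirac \<alpha> x y)"
proof
  interpret P: prob_space "pareto (2 * \<alpha>)"
    using assms by (intro prob_space_pareto) simp
  let ?p = "(min x y / max x y) powr \<alpha>"
  have "emeasure (kendall_dirac \<alpha> x y) (space (kendall_dirac \<alpha> x y))
      = (\<integral>\<^sup>+z. 1 \<partial>kendall_dirac \<alpha> x y)"
    by simp
  also have "\<dots> = ennreal ?p + ennreal (1 - ?p)"
    by (subst nn_integral_kendall_dirac) (auto simp: P.emeasure_space_1)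
  also have "\<dots> = 1"
    using ratio_powr_le_1[OF assms] by (simp flip: ennreal_plus)
  finally show "emeasure (kendall_dirac \<alpha> x y) (space (kendall_dirac \<alpha> x y)) = 1" .
qed

lemma AE_kendall_dirac_nonneg:
  assumes "0 \<le> x" "0 \<le> y"
  shows "AE z in kendall_dirac \<alpha> x y. 0 \<le> z"
proof (rule AE_I')
  have "emeasure (kendall_dirac \<alpha> x y) {..<0} = 0"
    using assms
    by (subst emeasure_kendall_dirac)
       (auto simp: indicator_def mult_less_0_iff max_def nn_integral_0_iff_AE)
  then show "{..<0} \<in> null_sets (kendall_dirac \<alpha> x y)"
    by auto
qed auto

text \<open>
  The integrands of \<open>F(t)\<close> and \<open>H(t)\<close>. Cutting off at \<open>0\<close> and dividing by \<open>t\<^sup>\<alpha>\<close> keeps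
  both between \<open>0\<close> and \<open>1\<close> for positive \<open>\<alpha>\<close> and \<open>t\<close>, so that they are integrable
  against every probability law.
\<close>

definition unit_step :: "real \<Rightarrow> real \<Rightarrow> real" where
  "unit_step t x = indicator {0..t} x"

definition truncated_power :: "real \<Rightarrow> real \<Rightarrow> real \<Rightarrow> real" where
  "truncated_power \<alpha> t x = (x / t) powr \<alpha> * indicator {0..t} x"

lemma measurable_unit_step [measurable]: "unit_step t \<in> borel_measurable borel"
  unfolding unit_step_def [abs_def] by measurable

lemma measurable_truncated_power [measurable]: "truncated_power \<alpha> t \<in> borel_measurable borel"
  unfolding truncated_power_def [abs_def] by measurable

lemma unit_step_bounds: "0 \<le> unit_step t x" "unit_step t x \<le> 1"
  by (auto simp: unit_step_def indicator_def)

lemma truncated_power_bounds: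
  assumes "0 < \<alpha>" "0 < t"
  shows "0 \<le> truncated_power \<alpha> t x" "truncated_power \<alpha> t x \<le> unit_step t x"
        "truncated_power \<alpha> t x \<le> 1"
proof -
  have "(x / t) powr \<alpha> \<le> 1" if "x \<in> {0..t}"
    using that powr_mono2[of \<alpha> "x / t" 1] assms by auto
  then show "0 \<le> truncated_power \<alpha> t x" "truncated_power \<alpha> t x \<le> unit_step t x"
        "truncated_power \<alpha> t x \<le> 1"
    by (auto simp: unit_step_def truncated_power_def indicator_def)
qed

text \<open>
  For \<open>y \<le> t\<close> put \<open>A = (y/t)\<^sup>\<alpha>\<close> and \<open>B = (x/t)\<^sup>\<alpha>\<close>. The Pareto part has weight \<open>B/A\<close>
  and contributes \<open>1 - A\<^sup>2\<close> to the first integral and \<open>2A(1 - A)\<close> to the second; the atom at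
  \<open>y\<close> contributes \<open>1\<close> and \<open>A\<close>. The weight depends on \<open>x\<close> and \<open>y\<close> only through
  \<open>B/A\<close>, and the result is symmetric in \<open>A\<close> and \<open>B\<close>. For \<open>y > t\<close> everything vanishes,
  because the Pareto law lives above \<open>1\<close>.
\<close>

lemma kendall_dirac_truncated_ordered:
  assumes "0 < \<alpha>" "0 < t" and xy: "0 \<le> x" "x \<le> y"
  shows "(\<integral>z. unit_step t z \<partial>kendall_dirac \<alpha> x y)
      = unit_step t x * unit_step t y - truncated_power \<alpha> t x * truncated_power \<alpha> t y" (is ?step)
    and "(\<integral>z. truncated_power \<alpha> t z \<partial>kendall_dirac \<alpha> x y)
      = truncated_power \<alpha> t x * unit_step t y + unit_step t x * truncated_power \<alpha> t y
        - 2 * truncated_power \<alpha> t x * truncated_power \<alpha> t y" (is ?power)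
proof -
  interpret P: prob_space "pareto (2 * \<alpha>)"
    using assms by (intro prob_space_pareto) simp
  have [simp]: "min x y = x" "max x y = y" using xy by auto
  have int1: "(\<integral>z. unit_step t z \<partial>kendall_dirac \<alpha> x y) = enn2real
       (ennreal ((x / y) powr \<alpha>) * (\<integral>\<^sup>+z. ennreal (unit_step t (y * z)) \<partial>pareto (2 * \<alpha>))
        + ennreal (1 - (x / y) powr \<alpha>) * ennreal (unit_step t y))"
    by (subst integral_eq_nn_integral) (auto simp: unit_step_bounds nn_integral_kendall_dirac)
  have int2: "(\<integral>z. truncated_power \<alpha> t z \<partial>kendall_dirac \<alpha> x y) = enn2real
       (ennreal ((x / y) powr \<alpha>) * (\<integral>\<^sup>+z. ennreal (truncated_power \<alpha> t (y * z)) \<partial>pareto (2 * \<alpha>))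
        + ennreal (1 - (x / y) powr \<alpha>) * ennreal (truncated_power \<alpha> t y))"
    by (subst integral_eq_nn_integral)
       (use assms in \<open>auto simp: truncated_power_bounds nn_integral_kendall_dirac\<close>)
  have AE1: "AE z in pareto (2 * \<alpha>). 1 \<le> z"
    unfolding pareto_def by (subst AE_density) (auto simp: indicator_def)
  consider "y = 0" | "t < y" | "0 < y" "y \<le> t" using xy by linarith
  then have "?step \<and> ?power"
  proof cases
    case 1
    then have "x = 0" using xy by simp
    then show ?thesis
      using 1 assms unfolding int1 int2 by (simp add: unit_step_def truncated_power_def)
  next
    case 2
    have "t < y * z" if "1 \<le> z" for z
    proof -
      have "y * 1 \<le> y * z" using that 2 assms(2) by (intro mult_left_mono) auto
      then show ?thesis using 2 by linarith
    qed
    then have zero: "AE z in pareto (2 * \<alpha>). unit_step t (y * z) = 0"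
        "AE z in pareto (2 * \<alpha>). truncated_power \<alpha> t (y * z) = 0"
      using AE1 by (auto simp: unit_step_def truncated_power_def indicator_def elim!: eventually_mono dest!: not_le_imp_less leD)
    have "(\<integral>\<^sup>+z. ennreal (unit_step t (y * z)) \<partial>pareto (2 * \<alpha>)) = (\<integral>\<^sup>+z. 0 \<partial>pareto (2 * \<alpha>))"
      using zero(1) by (intro nn_integral_cong_AE, eventually_elim) simp
    moreover have "(\<integral>\<^sup>+z. ennreal (truncated_power \<alpha> t (y * z)) \<partial>pareto (2 * \<alpha>)) = (\<integral>\<^sup>+z. 0 \<partial>pareto (2 * \<alpha>))"
      using zero(2) by (intro nn_integral_cong_AE, eventually_elim) simp
    ultimately show ?thesis
      using 2 assms unfolding int1 int2 by (simp add: unit_step_def truncated_power_def)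
  next
    case 3
    define A where "A = (y / t) powr \<alpha>"
    define B where "B = (x / t) powr \<alpha>"
    have A: "0 < A" "A \<le> 1" using 3 assms powr_mono2[of \<alpha> "y / t" 1] by (auto simp: A_def)
    have B: "0 \<le> B" "B \<le> A"
      using xy 3 assms by (auto simp: A_def B_def intro!: powr_mono2 divide_right_mono)
    have ratio: "(x / y) powr \<alpha> = B / A"
      using xy 3 assms by (simp add: A_def B_def powr_divide)
    have tA: "(t / y) powr - (2 * \<alpha>) = A * A" "(t / y) powr - \<alpha> = A"
      using 3 assms by (simp_all add: A_def powr_divide powr_minus field_simps flip: powr_add)
    have "(\<integral>\<^sup>+z. ennreal (unit_step t (y * z)) \<partial>pareto (2 * \<alpha>))
        = (\<integral>\<^sup>+z. ennreal (z powr 0 * indicator {..t / y} z) \<partial>pareto (2 * \<alpha>))"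
      using AE1 by (intro nn_integral_cong_AE, eventually_elim)
        (use 3 in \<open>auto simp: unit_step_def indicator_def field_simps\<close>)
    also have "\<dots> = ennreal (1 - A * A)"
      using 3 assms tA by (subst pareto_truncated_power_integral) auto
    finally have i1: "(\<integral>\<^sup>+z. ennreal (unit_step t (y * z)) \<partial>pareto (2 * \<alpha>)) = ennreal (1 - A * A)" .
    have "(\<integral>\<^sup>+z. ennreal (truncated_power \<alpha> t (y * z)) \<partial>pareto (2 * \<alpha>))
        = (\<integral>\<^sup>+z. ennreal A * ennreal (z powr \<alpha> * indicator {..t / y} z) \<partial>pareto (2 * \<alpha>))"
      using AE1
    proof (intro nn_integral_cong_AE, eventually_elim)
      case (elim z)
      have "(y * z / t) powr \<alpha> = A * z powr \<alpha>"
        using elim 3 assms powr_mult[of "y / t" z \<alpha>] by (simp add: A_def)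
      then show ?case
        using elim 3 assms A
        by (auto simp: truncated_power_def indicator_def field_simps ennreal_mult'[symmetric])
    qed
    also have "\<dots> = ennreal A * ennreal (2 * (1 - A))"
      using 3 assms tA by (subst nn_integral_cmult, simp, subst pareto_truncated_power_integral) auto
    finally have i2: "(\<integral>\<^sup>+z. ennreal (truncated_power \<alpha> t (y * z)) \<partial>pareto (2 * \<alpha>))
      = ennreal A * ennreal (2 * (1 - A))" .
    have step: "unit_step t x = 1" "unit_step t y = 1"
      "truncated_power \<alpha> t x = B" "truncated_power \<alpha> t y = A"
      using xy 3 by (auto simp: unit_step_def truncated_power_def A_def B_def)
    have r: "0 \<le> B / A" "B / A \<le> 1" using A B by (auto simp: divide_le_eq_1)
    have AA: "A * A \<le> 1" using A by (simp add: mult_le_one)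
    have "(\<integral>z. unit_step t z \<partial>kendall_dirac \<alpha> x y) = B / A * (1 - A * A) + (1 - B / A)"
      unfolding int1 i1 step ratio using r AA
      by (simp flip: ennreal_mult ennreal_plus del: times_divide_eq_left)
    moreover have "(\<integral>z. truncated_power \<alpha> t z \<partial>kendall_dirac \<alpha> x y)
        = B / A * (A * (2 * (1 - A))) + (1 - B / A) * A"
      unfolding int2 i2 step ratio using r A
      by (simp flip: ennreal_mult ennreal_plus del: times_divide_eq_left)
    moreover have "B / A * (1 - A * A) + (1 - B / A) = 1 * 1 - B * A"
      "B / A * (A * (2 * (1 - A))) + (1 - B / A) * A = B * 1 + 1 * A - 2 * B * A"
      using A by (simp_all add: field_simps)
    ultimately show ?thesis
      unfolding step by simp
  qed
  then show ?step ?power by auto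
qed

lemma kendall_dirac_truncated:
  assumes "0 < \<alpha>" "0 < t" "0 \<le> x" "0 \<le> y"
  shows "(\<integral>z. unit_step t z \<partial>kendall_dirac \<alpha> x y)
      = unit_step t x * unit_step t y - truncated_power \<alpha> t x * truncated_power \<alpha> t y" (is ?step)
    and "(\<integral>z. truncated_power \<alpha> t z \<partial>kendall_dirac \<alpha> x y)
      = truncated_power \<alpha> t x * unit_step t y + unit_step t x * truncated_power \<alpha> t y
        - 2 * truncated_power \<alpha> t x * truncated_power \<alpha> t y" (is ?power)
proof -
  have "?step \<and> ?power"
  proof (cases "x \<le> y")
    case True
    then show ?thesis
      using kendall_dirac_truncated_ordered assms by auto
  next
    case False
    then show ?thesis
      using kendall_dirac_truncated_ordered[of \<alpha> t y x] assms
      by (simp add: kendall_dirac_commute[of _ x y] mult.commute add.commute)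
  qed
  then show ?step ?power by auto
qed

section \<open>The convolution as a kernel applied to a product measure\<close>

text \<open>
  Clipping at \<open>0\<close> makes this a probability kernel on the whole plane without changing it on the
  quadrant that carries the laws in question, so that the Giry monad applies.
\<close>

definition kendall_kernel :: "real \<Rightarrow> real \<times> real \<Rightarrow> real measure" where
  "kendall_kernel \<alpha> = (\<lambda>(x, y). kendall_dirac \<alpha> (max 0 x) (max 0 y))"

lemma prob_space_kendall_kernel: "0 < \<alpha> \<Longrightarrow> prob_space (kendall_kernel \<alpha> z)"
  unfolding kendall_kernel_def case_prod_beta by (rule prob_space_kendall_dirac) simp_all

lemma measurable_kendall_kernel:
  assumes "0 < \<alpha>"
  shows "kendall_kernel \<alpha> \<in> measurable (borel \<Otimes>\<^sub>M borel) (subprob_algebra borel)"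
proof (rule measurable_subprob_algebra)
  fix z :: "real \<times> real"
  show "subprob_space (kendall_kernel \<alpha> z)"
    using assms by (intro prob_space_imp_subprob_space prob_space_kendall_kernel)
  show "sets (kendall_kernel \<alpha> z) = sets borel"
    by (simp add: kendall_kernel_def split: prod.splits)
next
  fix A :: "real set" assume "A \<in> sets borel"
  note [measurable] = emeasure_kendall_dirac_measurable[OF this]
  have "(\<lambda>z. (\<lambda>(x, y). emeasure (kendall_dirac \<alpha> x y) A) (max 0 (fst z), max 0 (snd z)))
      \<in> borel_measurable (borel \<Otimes>\<^sub>M borel)"
    by measurable
  then show "(\<lambda>z. emeasure (kendall_kernel \<alpha> z) A) \<in> borel_measurable (borel \<Otimes>\<^sub>M borel)"
    by (simp add: kendall_kernel_def case_prod_beta)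
qed

lemma measurable_kendall_kernel_product:
  assumes "0 < \<alpha>" "real_distribution \<mu>" "real_distribution \<nu>"
  shows "kendall_kernel \<alpha> \<in> measurable (\<mu> \<Otimes>\<^sub>M \<nu>) (subprob_algebra borel)"
proof -
  have sets_eq: "sets (\<mu> \<Otimes>\<^sub>M \<nu>) = sets (borel \<Otimes>\<^sub>M borel)"
    by (rule sets_pair_measure_cong[OF real_distribution.events_eq_borel[OF assms(2)]
          real_distribution.events_eq_borel[OF assms(3)]])
  show ?thesis
    using measurable_kendall_kernel[OF assms(1)] by (simp add: measurable_cong_sets[OF sets_eq refl])
qed

lemma kendall_conv_eq_bind:
  assumes "0 < \<alpha>" "nonneg_distribution \<mu>" "nonneg_distribution \<nu>"
  shows "kendall_conv \<alpha> \<mu> \<nu> = (\<mu> \<Otimes>\<^sub>M \<nu>) \<bind> kendall_kernel \<alpha>"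
proof -
  interpret \<mu>: nonneg_distribution \<mu> by fact
  interpret \<nu>: nonneg_distribution \<nu> by fact
  interpret P: pair_prob_space \<mu> \<nu> ..
  note kernel [measurable] = measurable_kendall_kernel_product[OF assms(1)
      \<mu>.real_distribution_axioms \<nu>.real_distribution_axioms]
  have sets_bind: "sets ((\<mu> \<Otimes>\<^sub>M \<nu>) \<bind> kendall_kernel \<alpha>) = sets borel"
    by (subst sets_bind[where N = borel])
       (auto simp: P.not_empty kendall_kernel_def)
  show ?thesis
  proof (rule measure_eqI)
    fix A assume "A \<in> sets (kendall_conv \<alpha> \<mu> \<nu>)"
    then have A: "A \<in> sets borel" by simp
    have m: "(\<lambda>z. emeasure (kendall_kernel \<alpha> z) A) \<in> borel_measurable (\<mu> \<Otimes>\<^sub>M \<nu>)"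
      using A by measurable
    have "emeasure ((\<mu> \<Otimes>\<^sub>M \<nu>) \<bind> kendall_kernel \<alpha>) A
        = (\<integral>\<^sup>+z. emeasure (kendall_kernel \<alpha> z) A \<partial>(\<mu> \<Otimes>\<^sub>M \<nu>))"
      by (rule emeasure_bind[OF P.not_empty kernel A])
    also have "\<dots> = (\<integral>\<^sup>+y. \<integral>\<^sup>+x. emeasure (kendall_kernel \<alpha> (x, y)) A \<partial>\<mu> \<partial>\<nu>)"
      using m by (rule P.nn_integral_snd[symmetric])
    also have "\<dots> = (\<integral>\<^sup>+y\<in>{0..}. (\<integral>\<^sup>+x\<in>{0..}. emeasure (kendall_dirac \<alpha> x y) A \<partial>\<mu>) \<partial>\<nu>)"
      using \<nu>.AE_nonneg
    proof (intro nn_integral_cong_AE, eventually_elim)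
      case (elim y)
      have "(\<integral>\<^sup>+x. emeasure (kendall_kernel \<alpha> (x, y)) A \<partial>\<mu>)
          = (\<integral>\<^sup>+x\<in>{0..}. emeasure (kendall_dirac \<alpha> x y) A \<partial>\<mu>)"
        using \<mu>.AE_nonneg by (intro nn_integral_cong_AE, eventually_elim)
          (use elim in \<open>auto simp: kendall_kernel_def max_absorb2\<close>)
      then show ?case using elim by simp
    qed
    also have "\<dots> = emeasure (kendall_conv \<alpha> \<mu> \<nu>) A"
      using A by (intro emeasure_kendall_conv[symmetric] \<mu>.real_distribution_axioms \<nu>.real_distribution_axioms)
    finally show "emeasure (kendall_conv \<alpha> \<mu> \<nu>) A = emeasure ((\<mu> \<Otimes>\<^sub>M \<nu>) \<bind> kendall_kernel \<alpha>) A" ..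
  qed (simp add: sets_bind)
qed

lemma nonneg_distribution_kendall_conv:
  assumes "0 < \<alpha>" "nonneg_distribution \<mu>" "nonneg_distribution \<nu>"
  shows "nonneg_distribution (kendall_conv \<alpha> \<mu> \<nu>)"
proof -
  interpret \<mu>: nonneg_distribution \<mu> by fact
  interpret \<nu>: nonneg_distribution \<nu> by fact
  interpret P: pair_prob_space \<mu> \<nu> ..
  note kernel [measurable] = measurable_kendall_kernel_product[OF assms(1)
      \<mu>.real_distribution_axioms \<nu>.real_distribution_axioms]
  have "prob_space (kendall_conv \<alpha> \<mu> \<nu>)"
    unfolding kendall_conv_eq_bind[OF assms] using assms(1)
    by (intro P.prob_space_bind[where S = borel] kernel)
       (simp add: prob_space_kendall_kernel)
  then interpret C: prob_space "kendall_conv \<alpha> \<mu> \<nu>" .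
  show ?thesis
  proof
    show "AE z in kendall_conv \<alpha> \<mu> \<nu>. 0 \<le> z"
      unfolding kendall_conv_eq_bind[OF assms]
    proof (subst AE_bind[where B = borel, OF kernel])
      have "AE z in kendall_kernel \<alpha> p. 0 \<le> z" for p
        unfolding kendall_kernel_def case_prod_beta by (rule AE_kendall_dirac_nonneg) simp_all
      then show "AE p in \<mu> \<Otimes>\<^sub>M \<nu>. AE z in kendall_kernel \<alpha> p. 0 \<le> z"
        by simp
    qed simp
  qed (simp_all add: sets_eq_imp_space_eq[OF sets_kendall_conv])
qed

definition mass_below :: "real measure \<Rightarrow> real \<Rightarrow> real" where
  "mass_below \<mu> t = (\<integral>x. unit_step t x \<partial>\<mu>)"

definition truncated_moment :: "real \<Rightarrow> real measure \<Rightarrow> real \<Rightarrow> real" where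
  "truncated_moment \<alpha> \<mu> t = (\<integral>x. truncated_power \<alpha> t x \<partial>\<mu>)"

text \<open>
  On point masses the integrals are polynomials in functions of one variable each, so integrating
  over the product measure factorizes them.
\<close>

lemma kendall_conv_truncated:
  assumes "0 < \<alpha>" "nonneg_distribution \<mu>" "nonneg_distribution \<nu>" "0 < t"
  shows "mass_below (kendall_conv \<alpha> \<mu> \<nu>) t
      = mass_below \<mu> t * mass_below \<nu> t - truncated_moment \<alpha> \<mu> t * truncated_moment \<alpha> \<nu> t"
    and "truncated_moment \<alpha> (kendall_conv \<alpha> \<mu> \<nu>) t
      = truncated_moment \<alpha> \<mu> t * mass_below \<nu> t + mass_below \<mu> t * truncated_moment \<alpha> \<nu> t
        - 2 * truncated_moment \<alpha> \<mu> t * truncated_moment \<alpha> \<nu> t"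
proof -
  interpret \<mu>: nonneg_distribution \<mu> by fact
  interpret \<nu>: nonneg_distribution \<nu> by fact
  interpret P: pair_prob_space \<mu> \<nu> ..
  note [measurable_cong] = \<mu>.events_eq_borel \<nu>.events_eq_borel
  note kernel [measurable] = measurable_kendall_kernel_product[OF assms(1)
      \<mu>.real_distribution_axioms \<nu>.real_distribution_axioms]
  let ?e = "unit_step t" and ?a = "truncated_power \<alpha> t"
  have prod: "integrable (\<mu> \<Otimes>\<^sub>M \<nu>) (\<lambda>z. f (fst z) * g (snd z))"
      "(\<integral>z. f (fst z) * g (snd z) \<partial>(\<mu> \<Otimes>\<^sub>M \<nu>)) = integral\<^sup>L \<mu> f * integral\<^sup>L \<nu> g"
    if [measurable]: "f \<in> borel_measurable borel" "g \<in> borel_measurable borel"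
      and "\<And>x. \<bar>f x\<bar> \<le> 1" "\<And>x. \<bar>g x\<bar> \<le> 1" for f g :: "real \<Rightarrow> real"
  proof -
    show int: "integrable (\<mu> \<Otimes>\<^sub>M \<nu>) (\<lambda>z. f (fst z) * g (snd z))"
      using that by (intro P.integrable_const_bound[where B = 1])
        (auto simp: abs_mult mult_le_one)
    show "(\<integral>z. f (fst z) * g (snd z) \<partial>(\<mu> \<Otimes>\<^sub>M \<nu>)) = integral\<^sup>L \<mu> f * integral\<^sup>L \<nu> g"
      using P.integral_fst'[OF int] by (simp add: mult.commute)
  qed
  have bound: "\<bar>?e x\<bar> \<le> 1" "\<bar>?a x\<bar> \<le> 1" for x
    using unit_step_bounds[of t x] truncated_power_bounds[OF assms(1,4), of x] by auto
  have AE_pos: "AE z in \<mu> \<Otimes>\<^sub>M \<nu>. 0 \<le> fst z \<and> 0 \<le> snd z"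
  proof (rule P.AE_pair_measure)
    show "{z \<in> space (\<mu> \<Otimes>\<^sub>M \<nu>). 0 \<le> fst z \<and> 0 \<le> snd z} \<in> sets (\<mu> \<Otimes>\<^sub>M \<nu>)"
      by measurable
    show "AE x in \<mu>. AE y in \<nu>. 0 \<le> fst (x, y) \<and> 0 \<le> snd (x, y)"
      using \<mu>.AE_nonneg by eventually_elim (use \<nu>.AE_nonneg in simp)
  qed
  have bind: "integral\<^sup>L (kendall_conv \<alpha> \<mu> \<nu>) f = (\<integral>z. integral\<^sup>L (kendall_kernel \<alpha> z) f \<partial>(\<mu> \<Otimes>\<^sub>M \<nu>))"
    if "f \<in> borel_measurable borel" "\<And>x. \<bar>f x\<bar> \<le> 1" for f :: "real \<Rightarrow> real"
    unfolding kendall_conv_eq_bind[OF assms(1-3)]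
    by (rule integral_bind[where K = borel and B = 1 and B' = 1])
       (use that kernel in \<open>auto simp: P.finite_measure_axioms prob_space.emeasure_space_1[OF prob_space_kendall_kernel[OF assms(1)]]\<close>)
  have "mass_below (kendall_conv \<alpha> \<mu> \<nu>) t
      = (\<integral>z. ?e (fst z) * ?e (snd z) - ?a (fst z) * ?a (snd z) \<partial>(\<mu> \<Otimes>\<^sub>M \<nu>))"
    unfolding mass_below_def bind[OF measurable_unit_step bound(1)]
  proof (rule integral_cong_AE)
    show "AE z in \<mu> \<Otimes>\<^sub>M \<nu>. integral\<^sup>L (kendall_kernel \<alpha> z) ?e
        = ?e (fst z) * ?e (snd z) - ?a (fst z) * ?a (snd z)"
      using AE_pos by eventually_elim
        (use assms in \<open>auto simp: kendall_kernel_def max_absorb2 kendall_dirac_truncated split: prod.splits\<close>)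
  qed measurable
  then show "mass_below (kendall_conv \<alpha> \<mu> \<nu>) t
      = mass_below \<mu> t * mass_below \<nu> t - truncated_moment \<alpha> \<mu> t * truncated_moment \<alpha> \<nu> t"
    by (simp add: prod bound mass_below_def truncated_moment_def)
  have "truncated_moment \<alpha> (kendall_conv \<alpha> \<mu> \<nu>) t
      = (\<integral>z. ?a (fst z) * ?e (snd z) + ?e (fst z) * ?a (snd z)
            - 2 * (?a (fst z) * ?a (snd z)) \<partial>(\<mu> \<Otimes>\<^sub>M \<nu>))"
    unfolding truncated_moment_def bind[OF measurable_truncated_power bound(2)]
  proof (rule integral_cong_AE)
    show "AE z in \<mu> \<Otimes>\<^sub>M \<nu>. integral\<^sup>L (kendall_kernel \<alpha> z) ?a
        = ?a (fst z) * ?e (snd z) + ?e (fst z) * ?a (snd z) - 2 * (?a (fst z) * ?a (snd z))"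
      using AE_pos by eventually_elim
        (use assms in \<open>auto simp: kendall_kernel_def max_absorb2 kendall_dirac_truncated split: prod.splits\<close>)
  qed measurable
  then show "truncated_moment \<alpha> (kendall_conv \<alpha> \<mu> \<nu>) t
      = truncated_moment \<alpha> \<mu> t * mass_below \<nu> t + mass_below \<mu> t * truncated_moment \<alpha> \<nu> t
        - 2 * truncated_moment \<alpha> \<mu> t * truncated_moment \<alpha> \<nu> t"
    by (simp add: prod bound mass_below_def truncated_moment_def)
qed

section \<open>Convolution powers and the law of the random walk\<close>

lemma nonneg_distribution_kendall_power:
  assumes "0 < \<alpha>" "nonneg_distribution \<nu>"
  shows "nonneg_distribution (kendall_power \<alpha> \<nu> (Suc n))"
  by (induction n) (use assms nonneg_distribution_kendall_conv in auto)

text \<open>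
  This is the integral of \<open>(1 - (x/t)\<^sup>\<alpha>)\<^sub>+\<close>, the Williamson transform at \<open>1/t\<close>. It plays
  the role of the characteristic function for the Kendall convolution.
\<close>

definition williamson :: "real \<Rightarrow> real measure \<Rightarrow> real \<Rightarrow> real" where
  "williamson \<alpha> \<mu> t = mass_below \<mu> t - truncated_moment \<alpha> \<mu> t"

lemma williamson_kendall_conv:
  assumes "0 < \<alpha>" "nonneg_distribution \<mu>" "nonneg_distribution \<nu>" "0 < t"
  shows "williamson \<alpha> (kendall_conv \<alpha> \<mu> \<nu>) t = williamson \<alpha> \<mu> t * williamson \<alpha> \<nu> t"
  by (simp add: williamson_def kendall_conv_truncated[OF assms] algebra_simps)

lemma williamson_kendall_power:
  assumes "0 < \<alpha>" "nonneg_distribution \<nu>" "0 < t"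
  shows "williamson \<alpha> (kendall_power \<alpha> \<nu> (Suc n)) t = williamson \<alpha> \<nu> t ^ Suc n"
proof (induction n)
  case (Suc n)
  then show ?case
    using williamson_kendall_conv[OF assms(1) nonneg_distribution_kendall_power[OF assms(1,2)] assms(2,3)]
    by simp
qed simp

text \<open>
  The product rule \<open>H\<^sub>1\<^sub>2 = H\<^sub>1 \<Phi>\<^sub>2 + \<Phi>\<^sub>1 H\<^sub>2\<close> makes this the derivative of a
  power.
\<close>

lemma truncated_moment_kendall_power:
  assumes "0 < \<alpha>" "nonneg_distribution \<nu>" "0 < t"
  shows "truncated_moment \<alpha> (kendall_power \<alpha> \<nu> (Suc n)) t
    = real (Suc n) * williamson \<alpha> \<nu> t ^ n * truncated_moment \<alpha> \<nu> t"
proof (induction n)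
  case (Suc n)
  let ?\<mu> = "kendall_power \<alpha> \<nu> (Suc n)"
  have "truncated_moment \<alpha> (kendall_power \<alpha> \<nu> (Suc (Suc n))) t
      = truncated_moment \<alpha> ?\<mu> t * williamson \<alpha> \<nu> t + williamson \<alpha> ?\<mu> t * truncated_moment \<alpha> \<nu> t"
    using kendall_conv_truncated(2)[OF assms(1) nonneg_distribution_kendall_power[OF assms(1,2)] assms(2,3)]
    by (simp add: williamson_def algebra_simps)
  then show ?case
    unfolding Suc.IH williamson_kendall_power[OF assms] by (simp add: algebra_simps)
qed simp

lemma (in nonneg_distribution) mass_below_eq_cdf:
  assumes "0 \<le> t"
  shows "mass_below \<mu> t = cdf \<mu> t"
proof -
  have "mass_below \<mu> t = measure \<mu> {0..t}"
    by (simp add: mass_below_def unit_step_def)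
  also have "\<dots> = measure \<mu> {..t}"
    using AE_nonneg by (intro finite_measure_eq_AE) (auto elim!: eventually_mono)
  finally show ?thesis
    by (simp add: cdf_def)
qed

lemma (in nonneg_distribution) tail_eq_mass_below: "0 \<le> t \<Longrightarrow> tail \<mu> t = 1 - mass_below \<mu> t"
  by (simp add: tail_def mass_below_eq_cdf)

lemma (in real_distribution) measure_greaterThan_eq_tail: "measure M {x<..} = tail M x"
proof -
  have "{x<..} = space M - {..x}" by auto
  then show ?thesis
    using prob_compl[of "{..x}"] by (simp add: tail_def cdf_def)
qed

lemma kendall_tail_closed_form:
  assumes "0 < \<alpha>" "nonneg_distribution \<nu>" "0 < t"
  shows "kendall_tail \<alpha> \<nu> (Suc n) t
    = 1 - williamson \<alpha> \<nu> t ^ Suc n - real (Suc n) * williamson \<alpha> \<nu> t ^ n * truncated_moment \<alpha> \<nu> t"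
proof -
  interpret P: nonneg_distribution "kendall_power \<alpha> \<nu> (Suc n)"
    using assms by (intro nonneg_distribution_kendall_power)
  have "kendall_tail \<alpha> \<nu> (Suc n) t = 1 - mass_below (kendall_power \<alpha> \<nu> (Suc n)) t"
    using assms by (simp add: kendall_tail_def P.measure_greaterThan_eq_tail P.tail_eq_mass_below)
  also have "mass_below (kendall_power \<alpha> \<nu> (Suc n)) t
      = williamson \<alpha> (kendall_power \<alpha> \<nu> (Suc n)) t + truncated_moment \<alpha> (kendall_power \<alpha> \<nu> (Suc n)) t"
    by (simp add: williamson_def)
  finally show ?thesis
    unfolding williamson_kendall_power[OF assms] truncated_moment_kendall_power[OF assms] by simp
qed

lemma nonneg_distribution_return:
  assumes "0 \<le> x"
  shows "nonneg_distribution (return borel x)"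
proof -
  interpret prob_space "return borel x"
    by (rule prob_space_return) simp
  have "AE z in return borel x. 0 \<le> z"
    using assms by (subst AE_return) auto
  then show ?thesis
    by (simp add: nonneg_distribution_def nonneg_distribution_axioms_def real_distribution_def
        real_distribution_axioms_def prob_space_axioms)
qed

text \<open>
  The expectation of the conditional probability of \<open>X (Suc n) \<in> A\<close> is its probability, and by
  the Markov property it is the integral over the law of \<open>X n\<close> of the mass that the convolution of
  a point mass with \<open>\<nu>\<close> gives to \<open>A\<close>. Fubini turns this into the double integral that defines
  the convolution.
\<close>

lemma kendall_walk_step:
  assumes "0 < \<alpha>" "nonneg_distribution \<nu>" "kendall_random_walk \<alpha> \<nu> M X" "1 \<le> n"
  shows "distr M borel (X (Suc n)) = kendall_conv \<alpha> (distr M borel (X n)) \<nu>"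
proof (rule measure_eqI)
  have X [measurable]: "X k \<in> borel_measurable M" and X_nonneg: "AE \<omega> in M. 0 \<le> X k \<omega>" for k
    using assms(3) by (auto simp: kendall_random_walk_def)
  interpret M: prob_space M
    using assms(3) by (simp add: kendall_random_walk_def)
  interpret \<nu>: nonneg_distribution \<nu> by fact
  interpret D: real_distribution "distr M borel (X n)"
    by (rule M.real_distribution_distr) simp
  fix A assume "A \<in> sets (distr M borel (X (Suc n)))"
  then have A [measurable]: "A \<in> sets borel" by simp
  define G where "G = sigma (space M) {X k -` B \<inter> space M | k B. k \<le> n \<and> B \<in> sets borel}"
  have "subalgebra M G"
    unfolding subalgebra_def G_def
  proof
    let ?S = "{X k -` B \<inter> space M | k B. k \<le> n \<and> B \<in> sets borel}"
    have "?S \<subseteq> sets M"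
      by (auto intro: measurable_sets[OF X])
    moreover from this have "?S \<subseteq> Pow (space M)"
      using sets.space_closed by blast
    ultimately show "sets (sigma (space M) ?S) \<subseteq> sets M"
      by (simp add: sets.sigma_sets_subset)
  qed (simp add: space_measure_of_conv)
  then interpret G: finite_measure_subalgebra M G
    by unfold_locales
  define I :: "'a \<Rightarrow> real" where "I = indicator (X (Suc n) -` A)"
  define R where "R = real_cond_exp M G I"
  have I_eq: "I \<omega> = indicator A (X (Suc n) \<omega>)" for \<omega>
    by (simp add: I_def indicator_def)
  have I_meas [measurable]: "I \<in> borel_measurable M"
    unfolding I_eq [abs_def] by measurable
  have I_int: "integrable M I"
    by (rule M.integrable_const_bound[where B = 1]) (auto simp: I_eq)
  have R_nonneg: "AE \<omega> in M. 0 \<le> R \<omega>"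
    unfolding R_def by (rule G.real_cond_exp_pos) (auto simp: I_eq)
  have R_eq: "AE \<omega> in M. R \<omega> = measure (kendall_conv \<alpha> (return borel (X n \<omega>)) \<nu>) A"
    using assms(3,4) A unfolding kendall_random_walk_def R_def G_def I_def by blast
  note [measurable] = emeasure_kendall_dirac_measurable[OF A]
  note [measurable_cong] = \<nu>.events_eq_borel
  define q where "q x = (\<integral>\<^sup>+y\<in>{0..}. emeasure (kendall_dirac \<alpha> x y) A \<partial>\<nu>)" for x
  have q_meas [measurable]: "q \<in> borel_measurable borel"
    unfolding q_def by measurable
  have step: "emeasure (kendall_conv \<alpha> (return borel x) \<nu>) A = q x" if "0 \<le> x" for x
  proof -
    interpret r: nonneg_distribution "return borel x"
      using that by (rule nonneg_distribution_return)
    show ?thesis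
      using that by (subst emeasure_kendall_conv)
        (auto simp: q_def nn_integral_return r.real_distribution_axioms \<nu>.real_distribution_axioms)
  qed
  have "emeasure (distr M borel (X (Suc n))) A = (\<integral>\<^sup>+x. indicator A x \<partial>distr M borel (X (Suc n)))"
    by simp
  also have "\<dots> = (\<integral>\<^sup>+\<omega>. ennreal (I \<omega>) \<partial>M)"
    by (subst nn_integral_distr) (simp_all add: I_eq ennreal_indicator)
  also have "\<dots> = ennreal (integral\<^sup>L M I)"
    by (rule nn_integral_eq_integral[OF I_int]) (simp add: I_eq)
  also have "integral\<^sup>L M I = integral\<^sup>L M R"
    unfolding R_def by (rule G.real_cond_exp_int(2)[OF I_int, symmetric])
  also have "ennreal (integral\<^sup>L M R) = (\<integral>\<^sup>+\<omega>. ennreal (R \<omega>) \<partial>M)"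
    using G.real_cond_exp_int(1)[OF I_int] R_nonneg
    unfolding R_def by (rule nn_integral_eq_integral[symmetric])
  also have "\<dots> = (\<integral>\<^sup>+\<omega>. q (X n \<omega>) \<partial>M)"
    using R_eq X_nonneg[of n]
  proof (intro nn_integral_cong_AE, eventually_elim)
    case (elim \<omega>)
    interpret c: nonneg_distribution "kendall_conv \<alpha> (return borel (X n \<omega>)) \<nu>"
      using elim by (intro nonneg_distribution_kendall_conv assms nonneg_distribution_return)
    show ?case
      using elim step[of "X n \<omega>"] by (simp add: c.emeasure_eq_measure)
  qed
  also have "\<dots> = (\<integral>\<^sup>+x. q x * indicator {0..} x \<partial>distr M borel (X n))"
    using X_nonneg[of n] by (subst nn_integral_distr)
      (auto intro!: nn_integral_cong_AE elim!: eventually_mono)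
  also have "\<dots> = (\<integral>\<^sup>+x. \<integral>\<^sup>+y. emeasure (kendall_dirac \<alpha> x y) A * indicator {0..} x * indicator {0..} y
      \<partial>\<nu> \<partial>distr M borel (X n))"
    unfolding q_def by (subst nn_integral_multc[symmetric]) (auto simp: ac_simps)
  also have "\<dots> = (\<integral>\<^sup>+y. \<integral>\<^sup>+x. emeasure (kendall_dirac \<alpha> x y) A * indicator {0..} x * indicator {0..} y
      \<partial>distr M borel (X n) \<partial>\<nu>)"
  proof -
    interpret P: pair_sigma_finite "distr M borel (X n)" \<nu> ..
    show ?thesis
      by (rule P.Fubini'[symmetric]) measurable
  qed
  also have "\<dots> = emeasure (kendall_conv \<alpha> (distr M borel (X n)) \<nu>) A"
    by (subst emeasure_kendall_conv[OF D.real_distribution_axioms \<nu>.real_distribution_axioms A])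
       (subst nn_integral_multc, auto)
  finally show "emeasure (distr M borel (X (Suc n))) A
      = emeasure (kendall_conv \<alpha> (distr M borel (X n)) \<nu>) A" .
qed simp

lemma kendall_walk_law:
  assumes "0 < \<alpha>" "nonneg_distribution \<nu>" "kendall_random_walk \<alpha> \<nu> M X" "1 \<le> n"
  shows "distr M borel (X n) = kendall_power \<alpha> \<nu> n"
  using assms(4)
proof (induction n rule: nat_induct_at_least)
  case base
  then show ?case
    using assms(3) by (simp add: kendall_random_walk_def)
next
  case (Suc n)
  then obtain m where "n = Suc m" by (cases n) auto
  then show ?case
    using kendall_walk_step[OF assms(1-3) Suc.hyps] Suc.IH by simp
qed

section \<open>Expansion of the tail for a fixed number of factors\<close>

lemma one_minus_power_first_order:
  "\<exists>C\<ge>0. \<forall>u::real. 0 \<le> u \<and> u \<le> 1 \<longrightarrow> \<bar>(1 - u) ^ n - (1 - real n * u)\<bar> \<le> C * u\<^sup>2"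
proof (induction n)
  case 0
  show ?case by (intro exI[of _ 0]) simp
next
  case (Suc n)
  then obtain C where C: "0 \<le> C"
    "\<And>u::real. 0 \<le> u \<Longrightarrow> u \<le> 1 \<Longrightarrow> \<bar>(1 - u) ^ n - (1 - real n * u)\<bar> \<le> C * u\<^sup>2" by blast
  have "\<bar>(1 - u) ^ Suc n - (1 - real (Suc n) * u)\<bar> \<le> (C + real n) * u\<^sup>2"
    if u: "0 \<le> u" "u \<le> 1" for u :: real
  proof -
    have "(1 - u) ^ Suc n - (1 - real (Suc n) * u)
        = (1 - u) * ((1 - u) ^ n - (1 - real n * u)) + real n * u\<^sup>2"
      by (simp add: algebra_simps power2_eq_square)
    also have "\<bar>\<dots>\<bar> \<le> \<bar>1 - u\<bar> * \<bar>(1 - u) ^ n - (1 - real n * u)\<bar> + \<bar>real n * u\<^sup>2\<bar>"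
      by (metis abs_mult abs_triangle_ineq)
    also have "\<dots> \<le> 1 * (C * u\<^sup>2) + real n * u\<^sup>2"
      using u C by (intro add_mono mult_mono) auto
    finally show ?thesis by (simp add: algebra_simps)
  qed
  then show ?case using C by (intro exI[of _ "C + real n"]) auto
qed

lemma one_minus_power_second_order:
  "\<exists>C\<ge>0. \<forall>u::real. 0 \<le> u \<and> u \<le> 1 \<longrightarrow>
     \<bar>(1 - u) ^ n - (1 - real n * u + real n * (real n - 1) / 2 * u\<^sup>2)\<bar> \<le> C * u ^ 3"
proof (induction n)
  case 0
  show ?case by (intro exI[of _ 0]) simp
next
  case (Suc n)
  let ?p = "\<lambda>n u. 1 - real n * u + real n * (real n - 1) / 2 * u\<^sup>2"
  let ?c = "real n * (real n - 1) / 2"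
  have c: "0 \<le> ?c" by (cases n) auto
  obtain C where C: "0 \<le> C"
    "\<And>u::real. 0 \<le> u \<Longrightarrow> u \<le> 1 \<Longrightarrow> \<bar>(1 - u) ^ n - ?p n u\<bar> \<le> C * u ^ 3" using Suc.IH by blast
  have "\<bar>(1 - u) ^ Suc n - ?p (Suc n) u\<bar> \<le> (C + ?c) * u ^ 3"
    if u: "0 \<le> u" "u \<le> 1" for u :: real
  proof -
    have "(1 - u) ^ Suc n - ?p (Suc n) u = (1 - u) * ((1 - u) ^ n - ?p n u) - ?c * u ^ 3"
      by (simp add: field_simps power2_eq_square power3_eq_cube)
    also have "\<bar>\<dots>\<bar> \<le> \<bar>1 - u\<bar> * \<bar>(1 - u) ^ n - ?p n u\<bar> + \<bar>?c * u ^ 3\<bar>"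
      by (metis abs_mult abs_triangle_ineq4)
    also have "\<dots> \<le> 1 * (C * u ^ 3) + ?c * u ^ 3"
      using u C c by (intro add_mono mult_mono) (auto simp only: abs_mult abs_of_nonneg zero_le_power abs_of_nonneg[of "1 - u"])
    finally show ?thesis by (simp add: algebra_simps)
  qed
  then show ?case using C c by (intro exI[of _ "C + ?c"]) auto
qed

lemma mass_and_moment_bounds:
  assumes "0 < \<alpha>" "nonneg_distribution \<nu>" "0 < t"
  shows "0 \<le> tail \<nu> t" "0 \<le> truncated_moment \<alpha> \<nu> t" "tail \<nu> t + truncated_moment \<alpha> \<nu> t \<le> 1"
    "williamson \<alpha> \<nu> t = 1 - (tail \<nu> t + truncated_moment \<alpha> \<nu> t)"
proof -
  interpret nonneg_distribution \<nu> by fact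
  have int: "integrable \<nu> (unit_step t)" "integrable \<nu> (truncated_power \<alpha> t)"
    using truncated_power_bounds[OF assms(1,3)] unit_step_bounds[of t]
    by (auto intro!: integrable_const_bound[where B = 1])
  have tail: "tail \<nu> t = 1 - mass_below \<nu> t"
    using assms by (simp add: tail_eq_mass_below)
  show "0 \<le> tail \<nu> t"
    using measure_greaterThan_eq_tail[of t] measure_nonneg[of \<nu> "{t<..}"] by simp
  show "0 \<le> truncated_moment \<alpha> \<nu> t"
    unfolding truncated_moment_def using truncated_power_bounds[OF assms(1,3)] by simp
  have "truncated_moment \<alpha> \<nu> t \<le> mass_below \<nu> t"
    unfolding truncated_moment_def mass_below_def
    using int truncated_power_bounds[OF assms(1,3)] by (intro integral_mono) auto
  then show "tail \<nu> t + truncated_moment \<alpha> \<nu> t \<le> 1"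
    by (simp add: tail)
  show "williamson \<alpha> \<nu> t = 1 - (tail \<nu> t + truncated_moment \<alpha> \<nu> t)"
    by (simp add: tail williamson_def)
qed

text \<open>
  With \<open>u = T + H\<close> the closed form is \<open>1 - (1-u)\<^sup>n - n(1-u)^(n-1) H\<close>. The power
  \<open>(1-u)\<^sup>n\<close> is needed to second order, but \<open>(1-u)^(n-1)\<close> only to first order since it is
  multiplied by \<open>H \<le> u\<close>. The quadratic part \<open>n(n-1)(u H - u\<^sup>2/2)\<close> equals
  \<open>n(n-1)/2 (H - T)(H + T)\<close>, which is where the mixed term disappears.
\<close>

lemma kendall_tail_expansion:
  assumes "0 < \<alpha>" "nonneg_distribution \<nu>" "1 \<le> n"
  obtains C where "0 \<le> C"
    "\<And>t. 0 < t \<Longrightarrow> \<bar>kendall_tail \<alpha> \<nu> n t - real n * tail \<nu> t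
        - real n * (real n - 1) / 2 * ((truncated_moment \<alpha> \<nu> t)\<^sup>2 - (tail \<nu> t)\<^sup>2)\<bar>
      \<le> C * (tail \<nu> t + truncated_moment \<alpha> \<nu> t) ^ 3"
proof -
  obtain k where n: "n = Suc k" using assms(3) by (cases n) auto
  obtain C1 where C1: "0 \<le> C1" "\<And>u::real. 0 \<le> u \<Longrightarrow> u \<le> 1 \<Longrightarrow> \<bar>(1 - u) ^ k - (1 - real k * u)\<bar> \<le> C1 * u\<^sup>2"
    using one_minus_power_first_order[of k] by blast
  obtain C2 where C2: "0 \<le> C2" "\<And>u::real. 0 \<le> u \<Longrightarrow> u \<le> 1 \<Longrightarrow>
      \<bar>(1 - u) ^ n - (1 - real n * u + real n * (real n - 1) / 2 * u\<^sup>2)\<bar> \<le> C2 * u ^ 3"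
    using one_minus_power_second_order[of n] by blast
  show thesis
  proof (rule that[of "C2 + real n * C1"])
    fix t :: real assume t: "0 < t"
    define T H u where "T = tail \<nu> t" and "H = truncated_moment \<alpha> \<nu> t" and "u = T + H"
    note defs = T_def[symmetric] H_def[symmetric]
    have TH: "0 \<le> T" "0 \<le> H" "0 \<le> u" "u \<le> 1" "H \<le> u" "williamson \<alpha> \<nu> t = 1 - u"
      using mass_and_moment_bounds[OF assms(1,2) t] by (auto simp: T_def H_def u_def)
    define e1 where "e1 = (1 - u) ^ k - (1 - real k * u)"
    define e2 where "e2 = (1 - u) ^ n - (1 - real n * u + real n * (real n - 1) / 2 * u\<^sup>2)"
    have "kendall_tail \<alpha> \<nu> n t = 1 - (1 - u) ^ n - real n * (1 - u) ^ k * H"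
      using kendall_tail_closed_form[OF assms(1,2) t, of k] TH(6) by (simp add: n H_def)
    also have "\<dots> = real n * u - real n * (real n - 1) / 2 * u\<^sup>2 - real n * H + real n * real k * u * H
        - e2 - real n * (e1 * H)"
      unfolding e1_def e2_def by (simp add: algebra_simps)
    also have "\<dots> = real n * T + real n * (real n - 1) / 2 * (H\<^sup>2 - T\<^sup>2) - e2 - real n * (e1 * H)"
      unfolding u_def n by (simp add: field_simps power2_eq_square)
    finally have "kendall_tail \<alpha> \<nu> n t - real n * T - real n * (real n - 1) / 2 * (H\<^sup>2 - T\<^sup>2)
        = - (e2 + real n * (e1 * H))" by simp
    also have "\<bar>\<dots>\<bar> \<le> \<bar>e2\<bar> + real n * (\<bar>e1\<bar> * \<bar>H\<bar>)"
      using abs_triangle_ineq[of e2 "real n * (e1 * H)"] by (simp add: abs_mult)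
    also have "\<dots> \<le> C2 * u ^ 3 + real n * (C1 * u\<^sup>2 * u)"
      using C1 C2 TH by (intro add_mono mult_left_mono mult_mono) (auto simp: e1_def e2_def)
    also have "\<dots> = (C2 + real n * C1) * u ^ 3"
      by (simp add: algebra_simps power2_eq_square power3_eq_cube)
    finally show "\<bar>kendall_tail \<alpha> \<nu> n t - real n * tail \<nu> t
        - real n * (real n - 1) / 2 * ((truncated_moment \<alpha> \<nu> t)\<^sup>2 - (tail \<nu> t)\<^sup>2)\<bar>
      \<le> (C2 + real n * C1) * (tail \<nu> t + truncated_moment \<alpha> \<nu> t) ^ 3"
      by (simp add: defs u_def)
  qed (use C1 C2 in simp)
qed

section \<open>Regularly varying tails\<close>

lemma relative_error_smallo:
  fixes f g :: "real \<Rightarrow> real"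
  assumes "((\<lambda>x. f x / g x) \<longlongrightarrow> 1) at_top" "\<forall>\<^sub>F x in at_top. g x \<noteq> 0"
  shows "\<exists>\<epsilon> \<in> o[at_top](\<lambda>_. 1 :: real). \<forall>\<^sub>F x in at_top. f x = g x * (1 + \<epsilon> x)"
proof
  show "(\<lambda>x. f x / g x - 1) \<in> o[at_top](\<lambda>_. 1 :: real)"
    using tendsto_diff[OF assms(1) tendsto_const[of 1]] by (intro smalloI_tendsto) auto
  show "\<forall>\<^sub>F x in at_top. f x = g x * (1 + (f x / g x - 1))"
    using assms(2) by eventually_elim simp
qed

lemma tail_tendsto_0: "real_distribution \<nu> \<Longrightarrow> (tail \<nu> \<longlongrightarrow> 0) at_top"
  unfolding tail_def [abs_def]
  using tendsto_diff[OF tendsto_const[of 1] real_distribution.cdf_lim_at_top_prob[of \<nu>]] by simp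

lemma tail_antimono: "real_distribution \<nu> \<Longrightarrow> s \<le> t \<Longrightarrow> tail \<nu> t \<le> tail \<nu> s"
  by (simp add: tail_def finite_borel_measure.cdf_nondecreasing real_distribution.axioms
      real_distribution.finite_borel_measure_M)

text \<open>
  Points below \<open>t\<close> contribute to \<open>H(2t)\<close> exactly \<open>2^(-\<alpha>)\<close> times their contribution to
  \<open>H(t)\<close>; all others contribute at most their mass.
\<close>

lemma truncated_moment_double:
  assumes "0 < \<alpha>" "nonneg_distribution \<nu>" "0 < t"
  shows "truncated_moment \<alpha> \<nu> (2 * t) \<le> 2 powr (- \<alpha>) * truncated_moment \<alpha> \<nu> t + tail \<nu> t"
proof -
  interpret nonneg_distribution \<nu> by fact
  have t2: "0 < 2 * t" using assms by simp
  have int: "integrable \<nu> (unit_step t)" "integrable \<nu> (truncated_power \<alpha> t)"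
      "integrable \<nu> (truncated_power \<alpha> (2 * t))"
    using truncated_power_bounds[OF assms(1,3)] truncated_power_bounds[OF assms(1) t2] unit_step_bounds[of t]
    by (auto intro!: integrable_const_bound[where B = 1])
  have "truncated_power \<alpha> (2 * t) x \<le> 2 powr (- \<alpha>) * truncated_power \<alpha> t x + (1 - unit_step t x)" for x
  proof (cases "0 \<le> x \<and> x \<le> t")
    case True
    have "(x / (2 * t)) powr \<alpha> = 2 powr (- \<alpha>) * (x / t) powr \<alpha>"
      using True assms by (simp add: powr_divide powr_mult powr_minus field_simps)
    then show ?thesis
      using True assms by (simp add: truncated_power_def unit_step_def)
  next
    case False
    then have "unit_step t x = 0" "truncated_power \<alpha> t x = 0"
      by (auto simp: truncated_power_def unit_step_def)
    then show ?thesis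
      using truncated_power_bounds[OF assms(1) t2] by simp
  qed
  then have "truncated_moment \<alpha> \<nu> (2 * t)
      \<le> (\<integral>x. 2 powr (- \<alpha>) * truncated_power \<alpha> t x + (1 - unit_step t x) \<partial>\<nu>)"
    unfolding truncated_moment_def using int by (intro integral_mono) auto
  also have "\<dots> = 2 powr (- \<alpha>) * truncated_moment \<alpha> \<nu> t + tail \<nu> t"
    using int assms by (simp add: truncated_moment_def tail_eq_mass_below mass_below_def prob_space[simplified])
  finally show ?thesis .
qed

text \<open>
  This stands in for Karamata's theorem: the limit relation for the factor \<open>2\<close> is iterated.
  For large \<open>t\<close> one has \<open>T(t) \<le> c T(2t)\<close> with \<open>c = 2^(\<alpha>-\<theta>/2)\<close>, so the doubling
  inequality makes the ratio \<open>R = H/T\<close> satisfy \<open>R(2t) \<le> q R(t) + c\<close> with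
  \<open>q = 2^(-\<theta>/2) < 1\<close>. Such a recursion stays bounded once it is bounded on a first dyadic
  interval, where \<open>H \<le> 1\<close> and \<open>T\<close> is bounded below.
\<close>

lemma truncated_moment_le_tail:
  assumes "0 < \<alpha>" "nonneg_distribution \<nu>" "0 < \<theta>" "\<theta> < \<alpha>" "regularly_varying (\<theta> - \<alpha>) (tail \<nu>)"
  obtains K where "0 \<le> K" "\<forall>\<^sub>F t in at_top. truncated_moment \<alpha> \<nu> t \<le> K * tail \<nu> t"
proof -
  interpret nonneg_distribution \<nu> by fact
  have anti: "s \<le> t \<Longrightarrow> tail \<nu> t \<le> tail \<nu> s" for s t
    by (rule tail_antimono[OF real_distribution_axioms])
  let ?T = "tail \<nu>" and ?H = "truncated_moment \<alpha> \<nu>"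
  have pos: "0 < ?T t" if "0 < t" for t
    using assms(5) that by (simp add: regularly_varying_def)
  define c where "c = 2 powr (\<alpha> - \<theta> / 2)"
  define q where "q = 2 powr (- \<alpha>) * c"
  have q: "0 < q" "q < 1" "0 < c"
    using assms powr_less_mono[of "- (\<theta> / 2)" 0 2] by (auto simp: q_def c_def powr_add[symmetric])
  have "((\<lambda>t. ?T (t * 2) / ?T t) \<longlongrightarrow> 2 powr (\<theta> - \<alpha>)) at_top"
    using assms(5) by (simp add: regularly_varying_def)
  moreover have "1 / c < 2 powr (\<theta> - \<alpha>)"
    using assms by (simp add: c_def powr_minus_divide[symmetric])
  ultimately have "\<forall>\<^sub>F t in at_top. 1 / c < ?T (t * 2) / ?T t"
    by (rule order_tendstoD(1))
  then obtain s where s: "\<And>t. s \<le> t \<Longrightarrow> 1 / c < ?T (t * 2) / ?T t"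
    by (auto simp: eventually_at_top_linorder)
  define t0 where "t0 = max s 1"
  have ratio: "?T t \<le> c * ?T (2 * t)" if "t0 \<le> t" for t
    using s[of t] pos[of t] q that by (simp add: t0_def field_simps)
  \<comment> \<open>The first entry makes the bound hold up to \<open>2 t\<^sub>0\<close>, the second is the fixed point of the
    recursion \<open>R \<mapsto> q R + c\<close>.\<close>
  define K where "K = max (1 / ?T (2 * t0)) (c / (1 - q))"
  have T0: "0 < ?T (2 * t0)" by (rule pos) (simp add: t0_def)
  have K: "0 \<le> K" "1 \<le> K * ?T (2 * t0)" "q * K + c \<le> K"
  proof -
    show "0 \<le> K" using T0 by (auto simp: K_def le_max_iff_disj)
    have "1 / ?T (2 * t0) \<le> K" "c / (1 - q) \<le> K" by (auto simp: K_def)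
    then show "1 \<le> K * ?T (2 * t0)" "q * K + c \<le> K"
      using T0 q by (auto simp: field_simps)
  qed
  have bound: "?H t \<le> K * ?T t" if "t0 \<le> t" "t \<le> 2 ^ n * (2 * t0)" for n t
    using that
  proof (induction n arbitrary: t)
    case 0
    then have "?H t \<le> 1"
      using mass_and_moment_bounds[OF assms(1,2), of t] by (simp add: t0_def)
    also have "1 \<le> K * ?T (2 * t0)" by fact
    also have "\<dots> \<le> K * ?T t"
      using anti[of t "2 * t0"] 0 K by (intro mult_left_mono) auto
    finally show ?case .
  next
    case (Suc n)
    show ?case
    proof (cases "t \<le> 2 * t0")
      case True
      have "?H t \<le> 1"
        using mass_and_moment_bounds[OF assms(1,2), of t] Suc.prems by (simp add: t0_def)
      also have "1 \<le> K * ?T (2 * t0)" by fact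
      also have "\<dots> \<le> K * ?T t"
        using anti[of t "2 * t0"] True K by (intro mult_left_mono) auto
      finally show ?thesis .
    next
      case False
      define r where "r = t / 2"
      have r: "t0 \<le> r" "r \<le> 2 ^ n * (2 * t0)" "t = 2 * r" "0 < r"
        using False Suc.prems by (auto simp: r_def t0_def)
      have "?H t \<le> 2 powr (- \<alpha>) * ?H r + ?T r"
        using truncated_moment_double[OF assms(1,2) r(4)] r(3) by simp
      also have "\<dots> \<le> 2 powr (- \<alpha>) * (K * ?T r) + ?T r"
        using Suc.IH[OF r(1,2)] by simp
      also have "\<dots> = (2 powr (- \<alpha>) * K + 1) * ?T r"
        by (simp add: algebra_simps)
      also have "\<dots> \<le> (2 powr (- \<alpha>) * K + 1) * (c * ?T t)"
        using ratio[OF r(1)] r(3) K by (intro mult_left_mono) auto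
      also have "\<dots> = (q * K + c) * ?T t"
        by (simp add: q_def algebra_simps)
      also have "\<dots> \<le> K * ?T t"
        using K(3) pos[of t] r by (intro mult_right_mono) auto
      finally show ?thesis .
    qed
  qed
  have "?H t \<le> K * ?T t" if "t0 \<le> t" for t
  proof -
    obtain n where "t / (2 * t0) < 2 ^ n"
      using real_arch_pow[of 2 "t / (2 * t0)"] by auto
    then show ?thesis
      using that by (intro bound[of t n]) (auto simp: field_simps t0_def)
  qed
  then show thesis
    using K(1) by (intro that[of K]) (auto simp: eventually_at_top_linorder)
qed

text \<open>
  Since \<open>H = O(T)\<close>, the quadratic and the cubic terms of the expansion are both \<open>O(T\<^sup>2)\<close>,
  and \<open>T\<close> tends to \<open>0\<close>.
\<close>

lemma kendall_tail_regularly_varying: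
  assumes "0 < \<alpha>" "nonneg_distribution \<nu>" "0 < \<theta>" "\<theta> < \<alpha>" "regularly_varying (\<theta> - \<alpha>) (tail \<nu>)"
    and "1 \<le> n"
  shows "((\<lambda>t. kendall_tail \<alpha> \<nu> n t / (real n * tail \<nu> t)) \<longlongrightarrow> 1) at_top"
proof -
  interpret nonneg_distribution \<nu> by fact
  let ?T = "tail \<nu>" and ?H = "truncated_moment \<alpha> \<nu>" and ?c = "real n * (real n - 1) / 2"
  have pos: "0 < ?T t" if "0 < t" for t
    using assms(5) that by (simp add: regularly_varying_def)
  obtain K where K: "0 \<le> K" "\<forall>\<^sub>F t in at_top. ?H t \<le> K * ?T t"
    using truncated_moment_le_tail[OF assms(1-5)] by blast
  obtain C where C: "0 \<le> C" "\<And>t. 0 < t \<Longrightarrow> \<bar>kendall_tail \<alpha> \<nu> n t - real n * ?T t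
        - ?c * ((?H t)\<^sup>2 - (?T t)\<^sup>2)\<bar> \<le> C * (?T t + ?H t) ^ 3"
    using kendall_tail_expansion[OF assms(1,2,6)] by blast
  define D where "D = (?c + C) * (1 + K)\<^sup>2"
  have T0: "(?T \<longlongrightarrow> 0) at_top"
    by (rule tail_tendsto_0[OF real_distribution_axioms])
  have "\<forall>\<^sub>F t in at_top. norm (kendall_tail \<alpha> \<nu> n t / ?T t - real n) \<le> D * ?T t"
    using K(2) eventually_gt_at_top[of 0]
  proof eventually_elim
    case (elim t)
    define T H where "T = ?T t" and "H = ?H t"
    have TH: "0 < T" "0 \<le> H" "T + H \<le> 1" "H \<le> K * T"
      using mass_and_moment_bounds[OF assms(1,2) elim(2)] pos elim by (auto simp: T_def H_def)
    have c: "0 \<le> ?c" using assms(6) by simp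
    have "\<bar>kendall_tail \<alpha> \<nu> n t - real n * T\<bar> \<le> \<bar>?c * (H\<^sup>2 - T\<^sup>2)\<bar> + C * (T + H) ^ 3"
      using C(2)[OF elim(2)] by (simp add: T_def H_def)
    also have "\<dots> \<le> ?c * (T + H)\<^sup>2 + C * (T + H)\<^sup>2"
    proof (rule add_mono)
      have "\<bar>H\<^sup>2 - T\<^sup>2\<bar> \<le> (T + H)\<^sup>2"
        using TH by (auto simp: abs_le_iff power2_eq_square algebra_simps)
      then show "\<bar>?c * (H\<^sup>2 - T\<^sup>2)\<bar> \<le> ?c * (T + H)\<^sup>2"
        using c by (simp only: abs_mult abs_of_nonneg mult_left_mono)
      show "C * (T + H) ^ 3 \<le> C * (T + H)\<^sup>2"
        using TH C by (intro mult_left_mono power_decreasing) auto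
    qed
    also have "\<dots> = (?c + C) * (T + H)\<^sup>2" by (simp add: algebra_simps)
    also have "\<dots> \<le> (?c + C) * ((1 + K) * T)\<^sup>2"
      using TH C c by (intro mult_left_mono power_mono) (auto simp: algebra_simps)
    also have "\<dots> = D * T * T" by (simp only: D_def power2_eq_square mult_ac)
    finally have "\<bar>kendall_tail \<alpha> \<nu> n t - real n * T\<bar> / T \<le> D * T"
      using TH by (simp add: divide_le_eq)
    moreover have "kendall_tail \<alpha> \<nu> n t / T - real n = (kendall_tail \<alpha> \<nu> n t - real n * T) / T"
      using TH by (simp add: field_simps)
    ultimately show ?case
      using TH by (simp add: T_def[symmetric] abs_divide)
  qed
  then have "((\<lambda>t. kendall_tail \<alpha> \<nu> n t / ?T t - real n) \<longlongrightarrow> 0) at_top"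
    by (rule Lim_null_comparison) (use tendsto_mult_left[OF T0, of D] in simp)
  then have "((\<lambda>t. kendall_tail \<alpha> \<nu> n t / ?T t) \<longlongrightarrow> real n) at_top"
    by (simp add: LIM_zero_iff)
  from tendsto_divide[OF this tendsto_const[of "real n"]] show ?thesis
    using assms(6) by (simp add: mult.commute)
qed

section \<open>Tails with a finite moment\<close>

lemma powr_truncated_power:
  assumes "0 < t"
  shows "t powr \<alpha> * truncated_power \<alpha> t x = x powr \<alpha> * indicator {0..t} x"
  using assms by (auto simp: truncated_power_def indicator_def powr_divide)

lemma nn_integral_truncated:
  assumes "0 < \<alpha>" "nonneg_distribution \<nu>" "0 < t"
  shows "(\<integral>\<^sup>+x. ennreal (x powr \<alpha> * indicator {0..t} x) \<partial>\<nu>)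
    = ennreal (t powr \<alpha> * truncated_moment \<alpha> \<nu> t)"
proof -
  interpret nonneg_distribution \<nu> by fact
  have "integrable \<nu> (truncated_power \<alpha> t)"
    using truncated_power_bounds[OF assms(1,3)] by (auto intro!: integrable_const_bound[where B = 1])
  then have "(\<integral>\<^sup>+x. ennreal (t powr \<alpha> * truncated_power \<alpha> t x) \<partial>\<nu>)
      = ennreal (\<integral>x. t powr \<alpha> * truncated_power \<alpha> t x \<partial>\<nu>)"
    using truncated_power_bounds[OF assms(1,3)] by (intro nn_integral_eq_integral) auto
  then show ?thesis
    unfolding powr_truncated_power[OF assms(3), symmetric] truncated_moment_def by simp
qed

text \<open>
  Let \<open>h(t) = t\<^sup>\<alpha> H(t)\<close> be the moment truncated at \<open>t\<close>. As soon as
  \<open>T(t) \<le> t^(-2\<alpha>)\<close>, the doubling inequality reads \<open>h(2t) \<le> h(t) + 2\<^sup>\<alpha> t^(-\<alpha>)\<close>. The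
  increments are geometric along \<open>t = 2\<^sup>k t\<^sub>0\<close>, hence \<open>h\<close> stays bounded there, and monotone
  convergence bounds the full moment.
\<close>

lemma moment_finite:
  assumes "0 < \<alpha>" "nonneg_distribution \<nu>" "tail \<nu> \<in> o[at_top](\<lambda>x. x powr (- 2 * \<alpha>))"
  shows "moment \<alpha> \<nu> < \<infinity>"
proof -
  interpret nonneg_distribution \<nu> by fact
  let ?h = "\<lambda>t. t powr \<alpha> * truncated_moment \<alpha> \<nu> t"
  have "\<forall>\<^sub>F x in at_top. norm (tail \<nu> x) \<le> 1 * norm (x powr (- 2 * \<alpha>))"
    using assms(3) by (rule landau_o.smallD) simp
  then obtain s where s: "\<And>t. s \<le> t \<Longrightarrow> tail \<nu> t \<le> t powr (- 2 * \<alpha>)"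
    unfolding eventually_at_top_linorder by fastforce
  define t0 where "t0 = max s 1"
  \<comment> \<open>The multiple of \<open>t^(-\<alpha>)\<close> whose decrease under doubling pays exactly for the increment
    of the truncated moment, so that \<open>g\<close> below does not grow.\<close>
  define D where "D = 2 powr \<alpha> / (1 - 2 powr (- \<alpha>))"
  have r: "2 powr (- \<alpha>) < 1"
    using powr_less_mono[of "- \<alpha>" 0 2] assms(1) by simp
  have "a + a / (1 - r) * r = a / (1 - r)" if "r < 1" for a r :: real
    using that by (simp add: field_simps)
  from this[OF r] r have D: "0 \<le> D" "2 powr \<alpha> + D * 2 powr (- \<alpha>) = D"
    by (simp_all add: D_def)
  define g where "g t = ?h t + D * t powr (- \<alpha>)" for t
  have double: "g (2 * t) \<le> g t" if t: "t0 \<le> t" for t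
  proof -
    have t': "0 < t" "s \<le> t" using t by (auto simp: t0_def)
    have "?h (2 * t) \<le> (2 * t) powr \<alpha> * (2 powr (- \<alpha>) * truncated_moment \<alpha> \<nu> t + t powr (- 2 * \<alpha>))"
      using truncated_moment_double[OF assms(1,2) t'(1)] s[OF t'(2)] by (intro mult_left_mono) auto
    also have "\<dots> = ?h t + 2 powr \<alpha> * t powr (- \<alpha>)"
    proof -
      have "2 powr \<alpha> * 2 powr (- \<alpha>) = (1::real)" "t powr \<alpha> * t powr (- 2 * \<alpha>) = t powr (- \<alpha>)"
        using t' by (simp_all flip: powr_add)
      then show ?thesis
        using t' by (simp add: powr_mult algebra_simps)
    qed
    finally have "g (2 * t) \<le> ?h t + (2 powr \<alpha> + D * 2 powr (- \<alpha>)) * t powr (- \<alpha>)"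
      using t' by (simp add: g_def powr_mult algebra_simps)
    then show ?thesis
      by (simp add: D g_def)
  qed
  have t0: "0 < 2 ^ k * t0" "t0 \<le> 2 ^ k * t0" for k :: nat
    using mult_right_mono[of 1 "2 ^ k" t0] by (auto simp: t0_def)
  have "g (2 ^ k * t0) \<le> g t0" for k
  proof (induction k)
    case (Suc k)
    have "g (2 ^ Suc k * t0) \<le> g (2 ^ k * t0)"
      using double[OF t0(2)[of k]] by (simp add: mult.assoc)
    then show ?case using Suc.IH by simp
  qed simp
  then have bound: "?h (2 ^ k * t0) \<le> g t0" for k
    using D(1) by (smt (verit) g_def mult_nonneg_nonneg powr_ge_zero)
  have SUP: "ennreal (x powr \<alpha>) * indicator {0..} x
      = (SUP k. ennreal (x powr \<alpha> * indicator {0..2 ^ k * t0} x))" for x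
  proof -
    obtain k where k: "x / t0 < 2 ^ k"
      using real_arch_pow[of 2 "x / t0"] by auto
    then have "x \<le> 2 ^ k * t0"
      by (simp add: t0_def field_simps)
    then have "ennreal (x powr \<alpha>) * indicator {0..} x
        \<le> (SUP k. ennreal (x powr \<alpha> * indicator {0..2 ^ k * t0} x))"
      by (intro SUP_upper2[of k]) (auto simp: indicator_def)
    moreover have "(SUP k. ennreal (x powr \<alpha> * indicator {0..2 ^ k * t0} x))
        \<le> ennreal (x powr \<alpha>) * indicator {0..} x"
      by (intro SUP_least) (auto simp: indicator_def)
    ultimately show ?thesis by (rule antisym)
  qed
  have "moment \<alpha> \<nu> = (SUP k. \<integral>\<^sup>+x. ennreal (x powr \<alpha> * indicator {0..2 ^ k * t0} x) \<partial>\<nu>)"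
    unfolding moment_def SUP
  proof (rule nn_integral_monotone_convergence_SUP)
    show "incseq (\<lambda>k x. ennreal (x powr \<alpha> * indicator {0..2 ^ k * t0} x))"
    proof (rule incseq_SucI, rule le_funI)
      fix k x
      have "0 \<le> t0" by (simp add: t0_def)
      then have "2 ^ k * t0 \<le> 2 ^ Suc k * t0" by simp
      then show "ennreal (x powr \<alpha> * indicator {0..2 ^ k * t0} x)
          \<le> ennreal (x powr \<alpha> * indicator {0..2 ^ Suc k * t0} x)"
        by (intro ennreal_leI mult_left_mono) (auto simp: indicator_def)
    qed
  qed simp
  also have "\<dots> \<le> ennreal (g t0)"
    by (intro SUP_least) (simp add: nn_integral_truncated[OF assms(1,2) t0(1)] bound ennreal_leI)
  finally show ?thesis
    by (simp add: le_less_trans)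
qed

text \<open>
  Both statements concern \<open>x\<^sup>\<alpha>\<close>: splitting it at \<open>t\<close> and replacing it by \<open>t\<^sup>\<alpha>\<close> above
  \<open>t\<close> gives the inequality, truncating it at \<open>t\<close> gives the limit. Together they force
  \<open>t\<^sup>\<alpha> T(t)\<close> to \<open>0\<close>.
\<close>

lemma moment_bounds:
  assumes "0 < \<alpha>" "nonneg_distribution \<nu>" "moment \<alpha> \<nu> < \<infinity>"
  shows "0 < t \<Longrightarrow> t powr \<alpha> * truncated_moment \<alpha> \<nu> t + t powr \<alpha> * tail \<nu> t \<le> enn2real (moment \<alpha> \<nu>)"
    and "((\<lambda>t. t powr \<alpha> * truncated_moment \<alpha> \<nu> t) \<longlongrightarrow> enn2real (moment \<alpha> \<nu>)) at_top"
proof -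
  interpret nonneg_distribution \<nu> by fact
  let ?f = "\<lambda>x. x powr \<alpha> * indicator {0..} x"
  have nn: "(\<integral>\<^sup>+x. ennreal (?f x) \<partial>\<nu>) = moment \<alpha> \<nu>"
    unfolding moment_def by (intro nn_integral_cong) (auto simp: indicator_def)
  have int: "integrable \<nu> ?f"
    using assms(3) by (intro integrableI_nonneg) (auto simp: nn)
  have m: "enn2real (moment \<alpha> \<nu>) = integral\<^sup>L \<nu> ?f"
    by (subst integral_eq_nn_integral) (auto simp: nn)
  show "t powr \<alpha> * truncated_moment \<alpha> \<nu> t + t powr \<alpha> * tail \<nu> t \<le> enn2real (moment \<alpha> \<nu>)" if t: "0 < t"
  proof -
    have int': "integrable \<nu> (unit_step t)" "integrable \<nu> (truncated_power \<alpha> t)"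
      using truncated_power_bounds[OF assms(1) t] unit_step_bounds[of t]
      by (auto intro!: integrable_const_bound[where B = 1])
    have "t powr \<alpha> * truncated_moment \<alpha> \<nu> t + t powr \<alpha> * tail \<nu> t
        = (\<integral>x. t powr \<alpha> * truncated_power \<alpha> t x + t powr \<alpha> * (1 - unit_step t x) \<partial>\<nu>)"
      using int' t by (simp add: truncated_moment_def tail_eq_mass_below mass_below_def prob_space[simplified])
    also have "\<dots> \<le> integral\<^sup>L \<nu> ?f"
    proof (rule integral_mono_AE)
      show "AE x in \<nu>. t powr \<alpha> * truncated_power \<alpha> t x + t powr \<alpha> * (1 - unit_step t x) \<le> ?f x"
        using AE_nonneg
      proof eventually_elim
        case (elim x)
        then show ?case
          using t assms(1) powr_mono2[of \<alpha> t x]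
          by (auto simp: powr_truncated_power unit_step_def indicator_def)
      qed
    qed (use int int' in auto)
    finally show ?thesis by (simp add: m)
  qed
  have "((\<lambda>t. \<integral>x. x powr \<alpha> * indicator {0..t} x \<partial>\<nu>) \<longlongrightarrow> integral\<^sup>L \<nu> ?f) at_top"
  proof (rule integral_dominated_convergence_at_top[where w = ?f])
    show "AE x in \<nu>. ((\<lambda>t. x powr \<alpha> * indicator {0..t} x) \<longlongrightarrow> ?f x) at_top"
    proof (rule AE_I2)
      fix x
      have "\<forall>\<^sub>F t in at_top. x powr \<alpha> * indicator {0..t} x = ?f x"
        using eventually_ge_at_top[of x] by eventually_elim (auto simp: indicator_def)
      then show "((\<lambda>t. x powr \<alpha> * indicator {0..t} x) \<longlongrightarrow> ?f x) at_top"
        by (rule tendsto_eventually)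
    qed
    show "\<forall>\<^sub>F t in at_top. AE x in \<nu>. norm (x powr \<alpha> * indicator {0..t} x) \<le> ?f x"
      by (intro always_eventually allI AE_I2) (auto simp: indicator_def)
  qed (use int in auto)
  moreover have "\<forall>\<^sub>F t in at_top. (\<integral>x. x powr \<alpha> * indicator {0..t} x \<partial>\<nu>) = t powr \<alpha> * truncated_moment \<alpha> \<nu> t"
    using eventually_gt_at_top[of 0]
    by eventually_elim (simp add: truncated_moment_def flip: powr_truncated_power)
  ultimately show "((\<lambda>t. t powr \<alpha> * truncated_moment \<alpha> \<nu> t) \<longlongrightarrow> enn2real (moment \<alpha> \<nu>)) at_top"
    unfolding m by (rule Lim_transform_eventually)
qed

text \<open>
  Multiplied by \<open>t^(2\<alpha>)\<close>, the quadratic term of the expansion becomes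
  \<open>(t\<^sup>\<alpha> H)\<^sup>2 - (t\<^sup>\<alpha> T)\<^sup>2\<close>, which tends to \<open>m\<^sup>2\<close>, and the cubic remainder
  becomes the cube of a bounded quantity times \<open>t^(-\<alpha>)\<close>.
\<close>

lemma kendall_tail_finite_moment:
  assumes "0 < \<alpha>" "nonneg_distribution \<nu>" "moment \<alpha> \<nu> < \<infinity>" "1 \<le> n"
  shows "((\<lambda>t. (kendall_tail \<alpha> \<nu> n t - real n * tail \<nu> t) / t powr (- 2 * \<alpha>))
    \<longlongrightarrow> 1 / 2 * real n * (real n - 1) * (enn2real (moment \<alpha> \<nu>))\<^sup>2) at_top"
proof -
  interpret nonneg_distribution \<nu> by fact
  let ?m = "enn2real (moment \<alpha> \<nu>)" and ?c = "real n * (real n - 1) / 2"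
  let ?H = "\<lambda>t. t powr \<alpha> * truncated_moment \<alpha> \<nu> t" and ?T = "\<lambda>t. t powr \<alpha> * tail \<nu> t"
  note mb = moment_bounds[OF assms(1-3)]
  obtain C where C: "0 \<le> C" "\<And>t. 0 < t \<Longrightarrow> \<bar>kendall_tail \<alpha> \<nu> n t - real n * tail \<nu> t
        - ?c * ((truncated_moment \<alpha> \<nu> t)\<^sup>2 - (tail \<nu> t)\<^sup>2)\<bar> \<le> C * (tail \<nu> t + truncated_moment \<alpha> \<nu> t) ^ 3"
    using kendall_tail_expansion[OF assms(1,2,4)] by blast
  have T0: "(?T \<longlongrightarrow> 0) at_top"
  proof (rule tendsto_sandwich)
    show "\<forall>\<^sub>F t in at_top. 0 \<le> ?T t"
      using eventually_gt_at_top[of 0] by eventually_elim (simp add: mass_and_moment_bounds[OF assms(1,2)])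
    show "\<forall>\<^sub>F t in at_top. ?T t \<le> ?m - ?H t"
      using eventually_gt_at_top[of 0] by eventually_elim (use mb(1) in \<open>simp add: algebra_simps\<close>)
    show "((\<lambda>t. ?m - ?H t) \<longlongrightarrow> 0) at_top"
      using tendsto_diff[OF tendsto_const[of ?m] mb(2)] by simp
  qed simp
  let ?R = "\<lambda>t. (kendall_tail \<alpha> \<nu> n t - real n * tail \<nu> t) / t powr (- 2 * \<alpha>)"
  have "((\<lambda>t. ?R t - ?c * ((?H t)\<^sup>2 - (?T t)\<^sup>2)) \<longlongrightarrow> 0) at_top"
  proof (rule Lim_null_comparison)
    show "((\<lambda>t. C * (?T t + ?H t) ^ 3 * t powr (- \<alpha>)) \<longlongrightarrow> 0) at_top"
      using tendsto_mult[OF tendsto_mult_left[OF tendsto_power[OF tendsto_add[OF T0 mb(2)]], of C 3]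
          tendsto_neg_powr[OF _ filterlim_ident, of "- \<alpha>"]] assms(1) by simp
    show "\<forall>\<^sub>F t in at_top. norm (?R t - ?c * ((?H t)\<^sup>2 - (?T t)\<^sup>2)) \<le> C * (?T t + ?H t) ^ 3 * t powr (- \<alpha>)"
      using eventually_gt_at_top[of 0]
    proof eventually_elim
      case (elim t)
      define p where "p = t powr \<alpha>"
      have p: "0 < p" "t powr (- 2 * \<alpha>) = 1 / p\<^sup>2" "t powr (- \<alpha>) = 1 / p"
        using elim by (simp_all add: p_def powr_minus_divide power2_eq_square flip: powr_add)
      have "?R t - ?c * ((?H t)\<^sup>2 - (?T t)\<^sup>2) = p\<^sup>2 * (kendall_tail \<alpha> \<nu> n t - real n * tail \<nu> t
        - ?c * ((truncated_moment \<alpha> \<nu> t)\<^sup>2 - (tail \<nu> t)\<^sup>2))"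
        unfolding p(2) p_def[symmetric] using p(1) by (simp add: field_simps)
      also have "\<bar>\<dots>\<bar> \<le> p\<^sup>2 * (C * (tail \<nu> t + truncated_moment \<alpha> \<nu> t) ^ 3)"
        unfolding abs_mult using C(2)[OF elim] by (intro mult_mono) auto
      also have "\<dots> = C * (?T t + ?H t) ^ 3 * t powr (- \<alpha>)"
        unfolding p(3) p_def[symmetric] distrib_left[symmetric] power_mult_distrib
        using p(1) by (simp add: power2_eq_square power3_eq_cube)
      finally show ?case by simp
    qed
  qed
  from tendsto_add[OF this tendsto_mult_left[OF tendsto_diff[OF tendsto_power[OF mb(2)] tendsto_power[OF T0]], of ?c 2 2]]
  show ?thesis by (simp add: algebra_simps)
qed

lemma zero_moment:
  assumes "0 < \<alpha>" "nonneg_distribution \<nu>" "moment \<alpha> \<nu> < \<infinity>" "enn2real (moment \<alpha> \<nu>) = 0" "0 < t"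
  shows "tail \<nu> t = 0" "kendall_tail \<alpha> \<nu> (Suc n) t = 0"
proof -
  have "t powr \<alpha> * (truncated_moment \<alpha> \<nu> t + tail \<nu> t) \<le> 0"
    using moment_bounds(1)[OF assms(1-3,5)] assms(4) by (simp add: distrib_left)
  then have "truncated_moment \<alpha> \<nu> t + tail \<nu> t \<le> 0"
    using assms(5) by (simp add: mult_le_0_iff not_le[symmetric])
  then have "tail \<nu> t = 0 \<and> truncated_moment \<alpha> \<nu> t = 0"
    using mass_and_moment_bounds[OF assms(1,2,5)] by linarith
  then show "tail \<nu> t = 0" "kendall_tail \<alpha> \<nu> (Suc n) t = 0"
    using mass_and_moment_bounds(4)[OF assms(1,2,5)]
    by (auto simp: kendall_tail_closed_form[OF assms(1,2,5)])
qed

text \<open>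
  A limit gives a relative error only where it is nonzero; in the degenerate case the equation itself
  must hold.
\<close>

lemma second_order_form:
  fixes f :: "real \<Rightarrow> real"
  assumes lim: "((\<lambda>t. f t / t powr (- 2 * \<alpha>)) \<longlongrightarrow> c) at_top"
    and zero: "c = 0 \<Longrightarrow> \<forall>\<^sub>F t in at_top. f t = 0"
  shows "\<exists>\<epsilon> \<in> o[at_top](\<lambda>_. 1 :: real). \<forall>\<^sub>F t in at_top. f t = c * t powr (- 2 * \<alpha>) * (1 + \<epsilon> t)"
proof (cases "c = 0")
  case True
  then show ?thesis
    using zero by (intro bexI[of _ "\<lambda>_. 0"]) auto
next
  case False
  show ?thesis
  proof (rule relative_error_smallo)
    show "((\<lambda>t. f t / (c * t powr (- 2 * \<alpha>))) \<longlongrightarrow> 1) at_top"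
      using tendsto_divide[OF lim tendsto_const[of c]] False by (simp add: mult.commute)
    show "\<forall>\<^sub>F t in at_top. c * t powr (- 2 * \<alpha>) \<noteq> 0"
      using eventually_gt_at_top[of 0] by eventually_elim (use False in simp)
  qed
qed

theorem corollary4p2:
  fixes \<alpha> :: real and \<nu> :: "real measure"
    and M :: "'a measure" and X :: "nat \<Rightarrow> 'a \<Rightarrow> real"
  assumes "\<alpha> > 0"
    and "real_distribution \<nu>"
    and "emeasure \<nu> {..<0} = 0"
  shows
    "(kendall_random_walk \<alpha> \<nu> M X \<longrightarrow>
        (\<forall>n\<ge>1. distr M borel (X n) = kendall_power \<alpha> \<nu> n))
   \<and> (\<forall>\<theta>. 0 < \<theta> \<and> \<theta> < \<alpha> \<and> regularly_varying (\<theta> - \<alpha>) (tail \<nu>) \<longrightarrow>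
        (\<forall>n\<ge>1. \<exists>\<epsilon> \<in> o[at_top](\<lambda>_. 1 :: real). \<forall>\<^sub>F x in at_top.
           kendall_tail \<alpha> \<nu> n x = real n * tail \<nu> x * (1 + \<epsilon> x)))
   \<and> (moment \<alpha> \<nu> < \<infinity> \<longrightarrow>
        (\<forall>n\<ge>1. \<exists>\<epsilon> \<in> o[at_top](\<lambda>_. 1 :: real). \<forall>\<^sub>F x in at_top.
           kendall_tail \<alpha> \<nu> n x = real n * tail \<nu> x
             + 1 / 2 * real n * (real n - 1) * (enn2real (moment \<alpha> \<nu>))\<^sup>2
                 * x powr (- 2 * \<alpha>) * (1 + \<epsilon> x)))
   \<and> (tail \<nu> \<in> o[at_top](\<lambda>x. x powr (- 2 * \<alpha>)) \<longrightarrow>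
        moment \<alpha> \<nu> < \<infinity>
      \<and> (\<forall>n\<ge>2. \<exists>\<epsilon> \<in> o[at_top](\<lambda>_. 1 :: real). \<forall>\<^sub>F x in at_top.
           kendall_tail \<alpha> \<nu> n x =
             1 / 2 * real n * (real n - 1) * (enn2real (moment \<alpha> \<nu>))\<^sup>2
                 * x powr (- 2 * \<alpha>) * (1 + \<epsilon> x))
      \<and> (\<forall>n\<ge>1. (\<lambda>x. kendall_tail \<alpha> \<nu> n x
             - 1 / 2 * real n * (real n - 1) * (enn2real (moment \<alpha> \<nu>))\<^sup>2
                 * x powr (- 2 * \<alpha>))
           \<in> o[at_top](\<lambda>x. x powr (- 2 * \<alpha>))))"
proof -
  interpret real_distribution \<nu> by fact
  have nonneg: "nonneg_distribution \<nu>"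
  proof
    show "AE x in \<nu>. 0 \<le> x"
      using assms(3) by (intro AE_I'[of "{..<0}"]) auto
  qed
  let ?c = "\<lambda>n. 1 / 2 * real n * (real n - 1) * (enn2real (moment \<alpha> \<nu>))\<^sup>2"
  have pos: "\<forall>\<^sub>F t::real in at_top. 0 < t" by (rule eventually_gt_at_top)
  have zero: "\<forall>\<^sub>F t in at_top. tail \<nu> t = 0 \<and> kendall_tail \<alpha> \<nu> n t = 0"
    if "moment \<alpha> \<nu> < \<infinity>" "enn2real (moment \<alpha> \<nu>) = 0" "1 \<le> n" for n
    using pos
  proof eventually_elim
    case (elim t)
    show ?case
      using zero_moment(1)[OF assms(1) nonneg that(1,2) elim]
        zero_moment(2)[OF assms(1) nonneg that(1,2) elim, of "n - 1"] that(3) by simp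
  qed
  have walk: "distr M borel (X n) = kendall_power \<alpha> \<nu> n"
    if "kendall_random_walk \<alpha> \<nu> M X" "1 \<le> n" for n
    using kendall_walk_law[OF assms(1) nonneg that] .
  have regular: "\<exists>\<epsilon> \<in> o[at_top](\<lambda>_. 1 :: real). \<forall>\<^sub>F x in at_top.
      kendall_tail \<alpha> \<nu> n x = real n * tail \<nu> x * (1 + \<epsilon> x)"
    if "0 < \<theta>" "\<theta> < \<alpha>" "regularly_varying (\<theta> - \<alpha>) (tail \<nu>)" "1 \<le> n" for \<theta> n
  proof (rule relative_error_smallo)
    show "((\<lambda>x. kendall_tail \<alpha> \<nu> n x / (real n * tail \<nu> x)) \<longlongrightarrow> 1) at_top"
      by (rule kendall_tail_regularly_varying[OF assms(1) nonneg that])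
    show "\<forall>\<^sub>F x in at_top. real n * tail \<nu> x \<noteq> 0"
      using pos by eventually_elim (use that in \<open>auto simp: regularly_varying_def dest!: spec\<close>)
  qed
  have finite_moment: "\<exists>\<epsilon> \<in> o[at_top](\<lambda>_. 1 :: real). \<forall>\<^sub>F x in at_top.
      kendall_tail \<alpha> \<nu> n x = real n * tail \<nu> x + ?c n * x powr (- 2 * \<alpha>) * (1 + \<epsilon> x)"
    if "moment \<alpha> \<nu> < \<infinity>" "1 \<le> n" for n
  proof -
    \<comment> \<open>The coefficient vanishes for a single factor and for the point mass at \<open>0\<close>.\<close>
    have "\<forall>\<^sub>F t in at_top. kendall_tail \<alpha> \<nu> n t - real n * tail \<nu> t = 0" if "?c n = 0"
    proof (cases "n = 1")
      case True
      then show ?thesis by (simp add: kendall_tail_def measure_greaterThan_eq_tail)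
    next
      case False
      then have "enn2real (moment \<alpha> \<nu>) = 0"
        using that \<open>1 \<le> n\<close> by auto
      from zero[OF \<open>moment \<alpha> \<nu> < \<infinity>\<close> this \<open>1 \<le> n\<close>] show ?thesis
        by eventually_elim simp
    qed
    from second_order_form[OF kendall_tail_finite_moment[OF assms(1) nonneg that] this]
    show ?thesis
      by (simp only: diff_eq_eq add.commute)
  qed
  have light: "moment \<alpha> \<nu> < \<infinity>"
      "1 \<le> n \<Longrightarrow> ((\<lambda>t. kendall_tail \<alpha> \<nu> n t / t powr (- 2 * \<alpha>)) \<longlongrightarrow> ?c n) at_top"
    if o: "tail \<nu> \<in> o[at_top](\<lambda>x. x powr (- 2 * \<alpha>))" for n
  proof -
    show fin: "moment \<alpha> \<nu> < \<infinity>"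
      by (rule moment_finite[OF assms(1) nonneg o])
    assume "1 \<le> n"
    from tendsto_add[OF kendall_tail_finite_moment[OF assms(1) nonneg fin this]
        tendsto_mult_left[OF smalloD_tendsto[OF o], of "real n"]]
    show "((\<lambda>t. kendall_tail \<alpha> \<nu> n t / t powr (- 2 * \<alpha>)) \<longlongrightarrow> ?c n) at_top"
      by (simp add: diff_divide_distrib)
  qed
  have light_relative: "\<exists>\<epsilon> \<in> o[at_top](\<lambda>_. 1 :: real). \<forall>\<^sub>F x in at_top.
      kendall_tail \<alpha> \<nu> n x = ?c n * x powr (- 2 * \<alpha>) * (1 + \<epsilon> x)"
    if o: "tail \<nu> \<in> o[at_top](\<lambda>x. x powr (- 2 * \<alpha>))" and n: "2 \<le> n" for n
  proof (rule second_order_form)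
    show "((\<lambda>t. kendall_tail \<alpha> \<nu> n t / t powr (- 2 * \<alpha>)) \<longlongrightarrow> ?c n) at_top"
      using light(2)[OF o] n by simp
    assume "?c n = 0"
    then have "enn2real (moment \<alpha> \<nu>) = 0" using n by auto
    from zero[OF light(1)[OF o] this, of n] n show "\<forall>\<^sub>F t in at_top. kendall_tail \<alpha> \<nu> n t = 0"
      by (auto elim: eventually_mono)
  qed
  have light_absolute: "(\<lambda>x. kendall_tail \<alpha> \<nu> n x - ?c n * x powr (- 2 * \<alpha>)) \<in> o[at_top](\<lambda>x. x powr (- 2 * \<alpha>))"
    if o: "tail \<nu> \<in> o[at_top](\<lambda>x. x powr (- 2 * \<alpha>))" and n: "1 \<le> n" for n
  proof (rule smalloI_tendsto)
    show "((\<lambda>x. (kendall_tail \<alpha> \<nu> n x - ?c n * x powr (- 2 * \<alpha>)) / x powr (- 2 * \<alpha>)) \<longlongrightarrow> 0) at_top"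
    proof (rule Lim_transform_eventually)
      show "((\<lambda>x. kendall_tail \<alpha> \<nu> n x / x powr (- 2 * \<alpha>) - ?c n) \<longlongrightarrow> 0) at_top"
        using tendsto_diff[OF light(2)[OF o n] tendsto_const[of "?c n"]] by simp
      show "\<forall>\<^sub>F x in at_top. kendall_tail \<alpha> \<nu> n x / x powr (- 2 * \<alpha>) - ?c n
          = (kendall_tail \<alpha> \<nu> n x - ?c n * x powr (- 2 * \<alpha>)) / x powr (- 2 * \<alpha>)"
        using pos by eventually_elim (simp add: diff_divide_distrib)
    qed
    show "\<forall>\<^sub>F x in at_top. x powr (- 2 * \<alpha>) \<noteq> 0"
      using pos by eventually_elim simp
  qed
  show ?thesis
    using walk regular finite_moment light(1) light_relative light_absolute by (intro conjI allI impI) blast+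
qed

end
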